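(* Consider the multiple regression model $\mathbf{y}_n=\mathbf{X}_n\boldsymbol\beta+\boldsymbol\varepsilon_n$, where $\{x_{ij}: 1\leqslant j\leqslant p,\ i\geqslant1\}$ are non-random real design levels, $\mathbf{X}_n=(x_{ij})_{1\leqslant i\leqslant n,1\leqslant j\leqslant p}$, $\boldsymbol\beta\in\mathbb{R}^p$ is unknown, $\boldsymbol\varepsilon_n=(\varepsilon_1,\ldots,\varepsilon_n)'$, and $\boldsymbol{\widehat\beta}_n=\boldsymbol\beta+(\mathbf{X}_n'\mathbf{X}_n)^{-1}\mathbf{X}_n'\boldsymbol\varepsilon_n$ is the least-squares estimator. Suppose $\{\varepsilon_n,n\geqslant1\}$ is a sequence of identically distributed pairwise PQD random variables with $\mathbb{E}|\varepsilon_1|^r<\infty$ for some $1\leqslant r<2$ and $\mathbb{E}\varepsilon_1=0$. Suppose there is $n_0$ such that $\mathbf{X}_n'\mathbf{X}_n$ is non-singular for $n\geqslant n_0$, and $\sup_{n\geqslant1}n^{-1}\sum_{k=1}^n x_{kj}^2<\infty$ for all $j$. Assume either (i) $r=1$, $[(\mathbf{X}_n'\mathbf{X}_n)^{-1}]_{jj}=O(1/n)$ as $n\to\infty$ for all $j$, and \[ \sum_{1\leqslant k<\ell<\infty}|x_{ki}x_{\ell j}|\int_\ell^\infty t^{-3}G_{\varepsilon_k,\varepsilon_\ell}(t)\,\mathrm{d}t<\infty\quad(i,j=1,\ldots,p); \] or (ii) $1<r<2$, $[(\mathbf{X}_n'\mathbf{X}_n)^{-1}]_{jj}=O\big(n^{-1/r}\operatorname{Log}^{-1}n\big)$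 as $n\to\infty$ for all $j$, and for some constant $C>0$ and some real sequence $(\lambda_\ell)$ with $\lambda_\ell=C\,\ell^{1/r}/\operatorname{Log}^{2/r}\ell+o\big(\ell^{1/r}/\operatorname{Log}^{2/r}\ell\big)$, \[ \sum_{1\leqslant k<\ell<\infty}|x_{ki}x_{\ell j}|\int_{\lambda_\ell}^\infty\left[\frac{1}{t^3\operatorname{Log}^2t}+\frac{1}{(t\vee\mathrm{e})t^2\operatorname{Log}^3t}\right]G_{\varepsilon_k,\varepsilon_\ell}(t)\,\mathrm{d}t<\infty\quad(i,j=1,\ldots,p). \] Then $\boldsymbol{\widehat\beta}_n\to\boldsymbol\beta$ almost surely.
   Context: $\operatorname{Log}x:=\log(|x|\vee\mathrm{e})$ and $\operatorname{Log}^a x=(\operatorname{Log}x)^a$. A sequence $\{\varepsilon_n\}$ is pairwise PQD if $\mathbb{P}\{\varepsilon_k\leqslant x,\varepsilon_j\leqslant y\}-\mathbb{P}\{\varepsilon_k\leqslant x\}\mathbb{P}\{\varepsilon_j\leqslant y\}\geqslant0$ for all reals $x,y$ and all $k\neq j$. For random variables $X,Y$ and $t>0$, $g_t(s)=\max(\min(s,t),-t)$, $\Delta_{X,Y}(x,y)=\mathbb{P}\{X\leqslant x,Y\leqslant y\}-\mathbb{P}\{X\leqslant x\}\mathbb{P}\{Y\leqslant y\}$, and $G_{X,Y}(t)=\mathrm{Cov}(g_t(X),g_t(Y))=\int_{-t}^t\int_{-t}^t\Delta_{X,Y}(x,y)\,\mathrm{d}x\,\mathrm{d}y$. *)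

theory Defs
  imports "HOL-Probability.Probability" "HOL-Library.Landau_Symbols"
begin

definition LogF :: "real \<Rightarrow> real" where
  "LogF x = ln (max \<bar>x\<bar> (exp 1))"

definition trunc_g :: "real \<Rightarrow> real \<Rightarrow> real" where
  "trunc_g t s = max (min s t) (- t)"

definition G_cov :: "'a measure \<Rightarrow> ('a \<Rightarrow> real) \<Rightarrow> ('a \<Rightarrow> real) \<Rightarrow> real \<Rightarrow> real" where
  "G_cov M X Y t =
     (\<integral>\<omega>. trunc_g t (X \<omega>) * trunc_g t (Y \<omega>) \<partial>M)
     - (\<integral>\<omega>. trunc_g t (X \<omega>) \<partial>M) * (\<integral>\<omega>. trunc_g t (Y \<omega>) \<partial>M)"

definition pairwise_PQD :: "'a measure \<Rightarrow> (nat \<Rightarrow> 'a \<Rightarrow> real) \<Rightarrow> bool" where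
  "pairwise_PQD M eps \<longleftrightarrow>
     (\<forall>k j (x::real) (y::real). 1 \<le> k \<longrightarrow> 1 \<le> j \<longrightarrow> k \<noteq> j \<longrightarrow>
        measure M {\<omega> \<in> space M. eps k \<omega> \<le> x \<and> eps j \<omega> \<le> y}
        - measure M {\<omega> \<in> space M. eps k \<omega> \<le> x} * measure M {\<omega> \<in> space M. eps j \<omega> \<le> y} \<ge> 0)"

definition XtX :: "(nat \<Rightarrow> 'p::finite \<Rightarrow> real) \<Rightarrow> nat \<Rightarrow> real^'p^'p" where
  "XtX x n = (\<chi> i j. \<Sum>k=1..n. x k i * x k j)"

definition lse :: "(nat \<Rightarrow> 'p::finite \<Rightarrow> real) \<Rightarrow> real^'p \<Rightarrow> (nat \<Rightarrow> 'a \<Rightarrow> real) \<Rightarrow> nat \<Rightarrow> 'a \<Rightarrow> real^'p" where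
  "lse x \<beta> eps n \<omega> = \<beta> + matrix_inv (XtX x n) *v (\<chi> j. \<Sum>k=1..n. x k j * eps k \<omega>)"

end

theory Submission
  imports Defs "HOL-Real_Asymp.Real_Asymp"
begin

text \<open>For \<open>B = (X'X)\<^sup>-\<^sup>1\<close> one has \<open>2 \<bar>B\<^sub>i\<^sub>j\<bar> \<le> B\<^sub>i\<^sub>i + B\<^sub>j\<^sub>j\<close>, so it suffices that
  \<open>S\<^sub>n = \<Sum>k\<le>n. a\<^sub>k \<epsilon>\<^sub>k\<close> is almost surely \<open>o(b\<^sub>n)\<close> for nonnegative weights (the positive and negative
  parts of a column of \<open>X\<close>), with \<open>b\<^sub>n = n\<close> in case (i) and \<open>b\<^sub>n = n\<^sup>1\<^sup>/\<^sup>r Log n\<close> in case (ii). By Hoeffding's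
  formula, for pairwise PQD variables the covariance of two clippings to subintervals of \<open>[-t, t]\<close>
  lies between \<open>0\<close> and \<open>G(t)\<close>, and the integral conditions bound \<open>G\<close> at the truncation levels because
  \<open>G\<close> is nondecreasing.

  In case (i) the positive and negative parts of \<open>\<epsilon>\<^sub>k\<close> clipped at \<open>k\<close> are treated separately by Etemadi's
  subsequence method. In case (ii) the error is clipped at \<open>k\<^sup>1\<^sup>/\<^sup>r\<close> and split again at \<open>k\<^sup>1\<^sup>/\<^sup>r / Log k\<close>. The
  inner part has enough spare logarithms for the Rademacher--Menshov maximal inequality. The outer
  part consists of nonnegative variables with partial means \<open>O(n\<^sup>1\<^sup>/\<^sup>r Log\<^sup>r\<^sup>-\<^sup>1 n) = o(b\<^sub>n)\<close>, so powers of
  two suffice as a subsequence.\<close>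

section \<open>Covariances of clipped variables\<close>

text \<open>Clipping is used rather than truncation by indicators because it is monotone and so
  preserves positive quadrant dependence: all covariances of clipped variables are nonnegative. This
  sign stands in for independence, since covariances over subintervals and over subblocks are then
  bounded by those over larger ones. The obstacle is the passage from a subsequence to all n. With
  norming n the partial means of the positive parts can be as large as the norming and no logarithm
  is to spare, so powers of two are too sparse and the finer grids \<open>i * 2 ^ j\<close> are
  used. For r > 1, the kernel integrated over [s, 2 s] yields at least a constant times G(s) / (s
  Log s)^2. At s = n^(1/r) / Log n this gives the weight n^(-2/r), larger by Log^2 n than the
  inverse square of the norming, which is the price of the maximal inequality; at s = n^(1/r) it
  gives that inverse square itself. The lower level is admissible because 2 / r > 1 puts it
  eventually above the lower limit of integration.\<close>

definition clip :: "real \<Rightarrow> real \<Rightarrow> real \<Rightarrow> real" where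
  "clip a b s = min b (max a s)"

lemma trunc_g_eq_clip: "0 \<le> t \<Longrightarrow> trunc_g t = clip (- t) t"
  by (auto simp: trunc_g_def clip_def fun_eq_iff)

lemma clip_measurable [measurable]: "clip a b \<in> borel_measurable borel"
  unfolding clip_def by measurable

lemma clip_bounds: "a \<le> b \<Longrightarrow> a \<le> clip a b s \<and> clip a b s \<le> b"
  by (auto simp: clip_def)

lemma abs_clip_le: "a \<le> b \<Longrightarrow> \<bar>clip a b s\<bar> \<le> \<bar>a\<bar> + \<bar>b\<bar>"
  by (auto simp: clip_def)

lemma clip_add: "a \<le> b \<Longrightarrow> b \<le> c \<Longrightarrow> clip a c s = clip a b s + clip b c s - b"
  by (auto simp: clip_def)

definition cov :: "'a measure \<Rightarrow> ('a \<Rightarrow> real) \<Rightarrow> ('a \<Rightarrow> real) \<Rightarrow> real" where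
  "cov M X Y = (\<integral>\<omega>. X \<omega> * Y \<omega> \<partial>M) - (\<integral>\<omega>. X \<omega> \<partial>M) * (\<integral>\<omega>. Y \<omega> \<partial>M)"

lemma cov_commute: "cov M X Y = cov M Y X"
  by (simp add: cov_def mult.commute)

lemma G_cov_eq_cov:
  "0 \<le> t \<Longrightarrow> G_cov M X Y t = cov M (\<lambda>\<omega>. clip (- t) t (X \<omega>)) (\<lambda>\<omega>. clip (- t) t (Y \<omega>))"
  by (simp add: G_cov_def cov_def trunc_g_eq_clip)

context prob_space
begin

lemma integrable_clip [simp]:
  "X \<in> borel_measurable M \<Longrightarrow> a \<le> b \<Longrightarrow> integrable M (\<lambda>\<omega>. clip a b (X \<omega>))"
  by (rule integrable_const_bound[where B = "\<bar>a\<bar> + \<bar>b\<bar>"]) (auto simp: abs_clip_le)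

lemma integrable_clip_mult [simp]:
  "X \<in> borel_measurable M \<Longrightarrow> Y \<in> borel_measurable M \<Longrightarrow> a \<le> b \<Longrightarrow> c \<le> d \<Longrightarrow>
   integrable M (\<lambda>\<omega>. clip a b (X \<omega>) * clip c d (Y \<omega>))"
  by (rule integrable_const_bound[where B = "(\<bar>a\<bar> + \<bar>b\<bar>) * (\<bar>c\<bar> + \<bar>d\<bar>)"])
    (auto simp: abs_clip_le abs_mult intro!: mult_mono)

text \<open>Layer cake: \<open>clip a b x - a\<close> is the length of the set of levels u in [a, b)
  below x, and Tonelli moves the level integral outside. The weight g carries the other variable,
  first as an indicator and then as its clipped value, so that Hoeffding's double integral is
  unfolded one level at a time.\<close>

lemma nn_integral_clip_layer:
  assumes [measurable]: "X \<in> borel_measurable M" "g \<in> borel_measurable M" and "a \<le> b"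
  shows "(\<integral>\<^sup>+\<omega>. ennreal (clip a b (X \<omega>) - a) * g \<omega> \<partial>M) =
    (\<integral>\<^sup>+u. indicator {a..<b} u * (\<integral>\<^sup>+\<omega>. indicator {\<omega> \<in> space M. u < X \<omega>} \<omega> * g \<omega> \<partial>M) \<partial>lborel)"
proof -
  interpret pair_sigma_finite M lborel ..
  have layer: "ennreal (clip a b (X \<omega>) - a) =
      (\<integral>\<^sup>+u. indicator {a..<b} u * indicator {..<X \<omega>} u \<partial>lborel)" for \<omega>
  proof -
    have "(\<lambda>u. indicator {a..<b} u * indicator {..<X \<omega>} u :: ennreal) = indicator {a..<clip a b (X \<omega>)}"
      by (auto simp: fun_eq_iff indicator_def clip_def)
    then show ?thesis using clip_bounds[OF \<open>a \<le> b\<close>, of "X \<omega>"] by simp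
  qed
  have "(\<integral>\<^sup>+\<omega>. ennreal (clip a b (X \<omega>) - a) * g \<omega> \<partial>M) =
      (\<integral>\<^sup>+\<omega>. \<integral>\<^sup>+u. indicator {a..<b} u * (indicator {..<X \<omega>} u * g \<omega>) \<partial>lborel \<partial>M)"
    by (simp add: layer nn_integral_multc[symmetric] mult.assoc)
  also have "\<dots> = (\<integral>\<^sup>+\<omega>. \<integral>\<^sup>+u. indicator {a..<b} u *
      (indicator {\<omega> \<in> space M. u < X \<omega>} \<omega> * g \<omega>) \<partial>lborel \<partial>M)"
    by (intro nn_integral_cong) (auto simp: indicator_def)
  also have "\<dots> = (\<integral>\<^sup>+u. \<integral>\<^sup>+\<omega>. indicator {a..<b} u *
      (indicator {\<omega> \<in> space M. u < X \<omega>} \<omega> * g \<omega>) \<partial>M \<partial>lborel)"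
    by (rule Fubini'[symmetric]) measurable
  also have "\<dots> = (\<integral>\<^sup>+u. indicator {a..<b} u *
      (\<integral>\<^sup>+\<omega>. indicator {\<omega> \<in> space M. u < X \<omega>} \<omega> * g \<omega> \<partial>M) \<partial>lborel)"
    by (intro nn_integral_cong nn_integral_cmult) measurable
  finally show ?thesis .
qed

section \<open>Positive quadrant dependence and covariances of clips\<close>

definition pqd :: "('a \<Rightarrow> real) \<Rightarrow> ('a \<Rightarrow> real) \<Rightarrow> bool" where
  "pqd X Y \<longleftrightarrow> (\<forall>x y. prob {\<omega> \<in> space M. X \<omega> \<le> x} * prob {\<omega> \<in> space M. Y \<omega> \<le> y}
      \<le> prob {\<omega> \<in> space M. X \<omega> \<le> x \<and> Y \<omega> \<le> y})"

lemma pqd_commute: "pqd X Y \<Longrightarrow> pqd Y X"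
  by (simp add: pqd_def conj_commute mult.commute)

text \<open>Complementing both events leaves the covariance of their indicators unchanged, by
  inclusion-exclusion. Strict upper events are the ones that the layer formula produces.\<close>

lemma pqd_upper:
  assumes [measurable]: "X \<in> borel_measurable M" "Y \<in> borel_measurable M" and "pqd X Y"
  shows "prob {\<omega> \<in> space M. x < X \<omega>} * prob {\<omega> \<in> space M. y < Y \<omega>}
      \<le> prob {\<omega> \<in> space M. x < X \<omega> \<and> y < Y \<omega>}"
proof -
  let ?A = "{\<omega> \<in> space M. X \<omega> \<le> x}" and ?B = "{\<omega> \<in> space M. Y \<omega> \<le> y}"
  have 1: "prob {\<omega> \<in> space M. x < X \<omega>} = 1 - prob ?A"
    by (subst prob_compl[symmetric]) (auto intro!: arg_cong[where f = prob])
  have 2: "prob {\<omega> \<in> space M. y < Y \<omega>} = 1 - prob ?B"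
    by (subst prob_compl[symmetric]) (auto intro!: arg_cong[where f = prob])
  have "{\<omega> \<in> space M. x < X \<omega> \<and> y < Y \<omega>} = space M - (?A \<union> ?B)" by auto
  then have 3: "prob {\<omega> \<in> space M. x < X \<omega> \<and> y < Y \<omega>} = 1 - prob (?A \<union> ?B)"
    by (simp add: prob_compl)
  have "prob (?A \<union> ?B) = prob ?A + prob ?B - prob (?A \<inter> ?B)"
    by (intro measure_Un3) (auto simp: fmeasurable_eq_sets)
  moreover have "?A \<inter> ?B = {\<omega> \<in> space M. X \<omega> \<le> x \<and> Y \<omega> \<le> y}" by auto
  moreover have "prob ?A * prob ?B \<le> prob {\<omega> \<in> space M. X \<omega> \<le> x \<and> Y \<omega> \<le> y}"
    using assms by (auto simp: pqd_def)
  ultimately show ?thesis unfolding 1 2 3 by (simp add: algebra_simps)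
qed

text \<open>Hoeffding's formula in the form of an inequality: \<open>pqd_upper\<close> gives it for
  each pair of levels, and integrating over v and then over u carries it to the clips. Subtracting
  the lower endpoints makes both factors nonnegative without changing the covariance, so the
  argument runs in extended nonnegative integrals and returns to the reals only at the end.\<close>

lemma cov_clip_nonneg:
  assumes [measurable]: "X \<in> borel_measurable M" "Y \<in> borel_measurable M"
    and "pqd X Y" "a \<le> b" "c \<le> d"
  shows "0 \<le> cov M (\<lambda>\<omega>. clip a b (X \<omega>)) (\<lambda>\<omega>. clip c d (Y \<omega>))"
proof -
  let ?f = "\<lambda>\<omega>. clip a b (X \<omega>) - a" and ?h = "\<lambda>\<omega>. clip c d (Y \<omega>) - c"
  let ?A = "\<lambda>u. {\<omega> \<in> space M. u < X \<omega>}" and ?B = "\<lambda>v. {\<omega> \<in> space M. v < Y \<omega>}"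
  have f0: "0 \<le> ?f \<omega>" and h0: "0 \<le> ?h \<omega>" for \<omega>
    using clip_bounds assms by auto
  have "emeasure M (?A u) * (\<integral>\<^sup>+\<omega>. ?h \<omega> \<partial>M) \<le> (\<integral>\<^sup>+\<omega>. indicator (?A u) \<omega> * ennreal (?h \<omega>) \<partial>M)" for u
  proof -
    have "emeasure M (?A u) * emeasure M (?B v) \<le>
        (\<integral>\<^sup>+\<omega>. indicator (?B v) \<omega> * indicator (?A u) \<omega> \<partial>M)" for v
    proof -
      have "?A u \<inter> ?B v = {\<omega> \<in> space M. u < X \<omega> \<and> v < Y \<omega>}" by auto
      then have "prob (?A u) * prob (?B v) \<le> prob (?A u \<inter> ?B v)"
        using pqd_upper[OF assms(1-3), of u v] by simp
      then have "emeasure M (?A u) * emeasure M (?B v) \<le> emeasure M (?A u \<inter> ?B v)"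
        by (simp only: emeasure_eq_measure ennreal_mult''[symmetric] measure_nonneg ennreal_leI)
      also have "\<dots> = (\<integral>\<^sup>+\<omega>. indicator (?A u \<inter> ?B v) \<omega> \<partial>M)" by simp
      also have "\<dots> = (\<integral>\<^sup>+\<omega>. indicator (?B v) \<omega> * indicator (?A u) \<omega> \<partial>M)"
        by (intro nn_integral_cong) (auto simp: indicator_def)
      finally show ?thesis .
    qed
    then have "(\<integral>\<^sup>+v. indicator {c..<d} v * (emeasure M (?A u) * emeasure M (?B v)) \<partial>lborel) \<le>
        (\<integral>\<^sup>+\<omega>. ennreal (?h \<omega>) * indicator (?A u) \<omega> \<partial>M)"
      using nn_integral_clip_layer[of Y "indicator (?A u)" c d] assms
      by (auto intro!: nn_integral_mono mult_left_mono)
    moreover have "(\<integral>\<^sup>+v. indicator {c..<d} v * (emeasure M (?A u) * emeasure M (?B v)) \<partial>lborel) =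
        emeasure M (?A u) * (\<integral>\<^sup>+\<omega>. ?h \<omega> \<partial>M)"
      using nn_integral_clip_layer[of Y "\<lambda>_. 1" c d] assms
      by (simp add: nn_integral_cmult[symmetric] mult_ac)
    ultimately show ?thesis by (simp add: mult.commute)
  qed
  then have "(\<integral>\<^sup>+u. indicator {a..<b} u * (emeasure M (?A u) * (\<integral>\<^sup>+\<omega>. ?h \<omega> \<partial>M)) \<partial>lborel) \<le>
      (\<integral>\<^sup>+\<omega>. ennreal (?f \<omega>) * ennreal (?h \<omega>) \<partial>M)"
    using nn_integral_clip_layer[of X "\<lambda>\<omega>. ennreal (?h \<omega>)" a b] assms
    by (auto intro!: nn_integral_mono mult_left_mono)
  moreover have "(\<integral>\<^sup>+u. indicator {a..<b} u * (emeasure M (?A u) * (\<integral>\<^sup>+\<omega>. ?h \<omega> \<partial>M)) \<partial>lborel) =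
      (\<integral>\<^sup>+\<omega>. ?f \<omega> \<partial>M) * (\<integral>\<^sup>+\<omega>. ?h \<omega> \<partial>M)"
    using nn_integral_clip_layer[of X "\<lambda>_. 1" a b] assms
    by (simp add: nn_integral_multc mult.assoc[symmetric])
  ultimately have le: "(\<integral>\<^sup>+\<omega>. ?f \<omega> \<partial>M) * (\<integral>\<^sup>+\<omega>. ?h \<omega> \<partial>M) \<le> (\<integral>\<^sup>+\<omega>. ?f \<omega> * ?h \<omega> \<partial>M)"
    using f0 h0 by (simp add: ennreal_mult)
  have int: "integrable M ?f" "integrable M ?h" "integrable M (\<lambda>\<omega>. ?f \<omega> * ?h \<omega>)"
    using assms by (auto simp: algebra_simps)
  have "expectation ?f * expectation ?h \<le> expectation (\<lambda>\<omega>. ?f \<omega> * ?h \<omega>)"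
    using le int f0 h0
    by (simp add: nn_integral_eq_integral ennreal_mult[symmetric] integral_nonneg_AE)
  moreover have "expectation (\<lambda>\<omega>. ?f \<omega> * ?h \<omega>) = expectation (\<lambda>\<omega>. clip a b (X \<omega>) * clip c d (Y \<omega>))
      - c * expectation (\<lambda>\<omega>. clip a b (X \<omega>)) - a * expectation (\<lambda>\<omega>. clip c d (Y \<omega>)) + a * c"
    using assms by (simp add: algebra_simps prob_space)
  moreover have "expectation ?f = expectation (\<lambda>\<omega>. clip a b (X \<omega>)) - a"
    "expectation ?h = expectation (\<lambda>\<omega>. clip c d (Y \<omega>)) - c"
    using assms by (auto simp: prob_space)
  ultimately show ?thesis
    by (simp add: cov_def algebra_simps)
qed

text \<open>Cutting the wide interval at a and b writes the wide clip as three adjacent clips plus a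
  constant. The constant drops out of the covariance, and the two outer pieces contribute
  nonnegatively.\<close>

lemma cov_clip_mono_left:
  assumes [measurable]: "X \<in> borel_measurable M" "Y \<in> borel_measurable M"
    and "pqd X Y" "a' \<le> a" "a \<le> b" "b \<le> b'" "c \<le> d"
  shows "cov M (\<lambda>\<omega>. clip a b (X \<omega>)) (\<lambda>\<omega>. clip c d (Y \<omega>))
    \<le> cov M (\<lambda>\<omega>. clip a' b' (X \<omega>)) (\<lambda>\<omega>. clip c d (Y \<omega>))"
proof -
  have eq: "clip a' b' s = clip a' a s + clip a b s + clip b b' s - (a + b)" for s
    using clip_add[of a' a b' s] clip_add[of a b b' s] assms by simp
  have "cov M (\<lambda>\<omega>. clip a' b' (X \<omega>)) (\<lambda>\<omega>. clip c d (Y \<omega>)) =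
      cov M (\<lambda>\<omega>. clip a' a (X \<omega>)) (\<lambda>\<omega>. clip c d (Y \<omega>)) +
      cov M (\<lambda>\<omega>. clip a b (X \<omega>)) (\<lambda>\<omega>. clip c d (Y \<omega>)) +
      cov M (\<lambda>\<omega>. clip b b' (X \<omega>)) (\<lambda>\<omega>. clip c d (Y \<omega>))"
    using assms unfolding cov_def eq by (simp add: algebra_simps prob_space)
  then show ?thesis
    using cov_clip_nonneg[of X Y a' a c d] cov_clip_nonneg[of X Y b b' c d] assms by simp
qed

lemma cov_clip_mono:
  assumes "X \<in> borel_measurable M" "Y \<in> borel_measurable M"
    and "pqd X Y" "a' \<le> a" "a \<le> b" "b \<le> b'" "c' \<le> c" "c \<le> d" "d \<le> d'"
  shows "cov M (\<lambda>\<omega>. clip a b (X \<omega>)) (\<lambda>\<omega>. clip c d (Y \<omega>))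
    \<le> cov M (\<lambda>\<omega>. clip a' b' (X \<omega>)) (\<lambda>\<omega>. clip c' d' (Y \<omega>))"
  using cov_clip_mono_left[of X Y a' a b b' c d] cov_clip_mono_left[of Y X c' c d d' a' b'] assms
  by (simp add: pqd_commute cov_commute[of M "\<lambda>\<omega>. clip a' b' (X \<omega>)"])

lemma expectation_centered_sum_square:
  fixes Z :: "nat \<Rightarrow> 'a \<Rightarrow> real"
  assumes "finite I" "\<And>k. k \<in> I \<Longrightarrow> integrable M (Z k)"
    "\<And>k l. k \<in> I \<Longrightarrow> l \<in> I \<Longrightarrow> integrable M (\<lambda>\<omega>. Z k \<omega> * Z l \<omega>)"
  shows "integrable M (\<lambda>\<omega>. (\<Sum>k\<in>I. a k * (Z k \<omega> - expectation (Z k)))\<^sup>2)"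
    and "expectation (\<lambda>\<omega>. (\<Sum>k\<in>I. a k * (Z k \<omega> - expectation (Z k)))\<^sup>2)
      = (\<Sum>k\<in>I. \<Sum>l\<in>I. a k * a l * cov M (Z k) (Z l))"
proof -
  let ?D = "\<lambda>k \<omega>. a k * (Z k \<omega> - expectation (Z k))"
  have sq: "(\<Sum>k\<in>I. ?D k \<omega>)\<^sup>2 = (\<Sum>k\<in>I. \<Sum>l\<in>I. ?D k \<omega> * ?D l \<omega>)" for \<omega>
    by (simp add: power2_eq_square sum_product)
  have D: "?D k \<omega> * ?D l \<omega> = a k * a l * (Z k \<omega> * Z l \<omega> - expectation (Z l) * Z k \<omega>
      - expectation (Z k) * Z l \<omega> + expectation (Z k) * expectation (Z l))" for k l \<omega>
    by (simp add: algebra_simps)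
  show "integrable M (\<lambda>\<omega>. (\<Sum>k\<in>I. ?D k \<omega>)\<^sup>2)"
    unfolding sq D using assms by (intro Bochner_Integration.integrable_sum integrable_mult_right
      Bochner_Integration.integrable_add Bochner_Integration.integrable_diff) auto
  have "integrable M (\<lambda>\<omega>. ?D k \<omega> * ?D l \<omega>)" if "k \<in> I" "l \<in> I" for k l
    unfolding D using assms that by (intro integrable_mult_right
      Bochner_Integration.integrable_add Bochner_Integration.integrable_diff) auto
  moreover have "expectation (\<lambda>\<omega>. ?D k \<omega> * ?D l \<omega>) = a k * a l * cov M (Z k) (Z l)"
    if "k \<in> I" "l \<in> I" for k l
    unfolding D using assms that by (simp add: cov_def prob_space)
  ultimately show "expectation (\<lambda>\<omega>. (\<Sum>k\<in>I. ?D k \<omega>)\<^sup>2) =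
      (\<Sum>k\<in>I. \<Sum>l\<in>I. a k * a l * cov M (Z k) (Z l))"
    unfolding sq by (simp add: Bochner_Integration.integral_sum)
qed

end

section \<open>Dyadic summation\<close>

text \<open>Exchanging the sums would give each \<open>c l\<close> a geometric series that starts at
  the first grid point past l; the induction achieves the same. The additional \<open>p J\<close> on
  the left is what the step consumes, since halving bounds \<open>2 * p (Suc J)\<close> by
  \<open>p J\<close> plus twice the new block.\<close>

lemma dyadic_partial_sums:
  fixes w c :: "nat \<Rightarrow> real"
  assumes anti: "\<And>m n. 1 \<le> m \<Longrightarrow> m \<le> n \<Longrightarrow> w n \<le> w m"
    and half: "\<And>n. 1 \<le> n \<Longrightarrow> w (2 * n) \<le> w n / 2"
    and c0: "\<And>l. 1 \<le> l \<Longrightarrow> 0 \<le> c l" and i: "1 \<le> i"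
  defines "p \<equiv> \<lambda>j. w (i * 2 ^ j) * (\<Sum>l=1..i * 2 ^ j. c l)"
  shows "(\<Sum>j\<le>J. p j) + p J \<le> 2 * (\<Sum>l=1..i * 2 ^ J. w l * c l)"
proof (induction J)
  case 0
  have "w i * (\<Sum>l=1..i. c l) \<le> (\<Sum>l=1..i. w l * c l)"
    unfolding sum_distrib_left by (intro sum_mono mult_right_mono anti c0) auto
  then show ?case by (simp add: p_def)
next
  case (Suc J)
  let ?n = "i * 2 ^ J"
  have n1: "1 \<le> ?n" using i by simp
  have split: "(\<Sum>l=1..2 * ?n. g l) = (\<Sum>l=1..?n. g l) + (\<Sum>l=?n+1..2 * ?n. g l)"
    for g :: "nat \<Rightarrow> real"
    using sum.ub_add_nat[of 1 ?n g ?n] by (simp add: mult_2)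
  have Suc_eq: "i * 2 ^ Suc J = 2 * ?n" by simp
  have "2 * p (Suc J) = 2 * w (2 * ?n) * (\<Sum>l=1..?n. c l) + 2 * (\<Sum>l=?n+1..2 * ?n. w (2 * ?n) * c l)"
    unfolding p_def Suc_eq split by (simp add: algebra_simps sum_distrib_left)
  also have "\<dots> \<le> w ?n * (\<Sum>l=1..?n. c l) + 2 * (\<Sum>l=?n+1..2 * ?n. w l * c l)"
    using half[OF n1] n1
    by (intro add_mono mult_right_mono mult_left_mono sum_mono anti sum_nonneg c0) auto
  also have "\<dots> = p J + 2 * (\<Sum>l=?n+1..2 * ?n. w l * c l)" by (simp add: p_def)
  finally show ?case using Suc unfolding Suc_eq split by simp
qed

text \<open>The starting point i is arbitrary because the gap-filling argument needs every sequence
  \<open>i * 2 ^ j\<close>, not only the powers of two.\<close>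

lemma summable_dyadic:
  fixes w c :: "nat \<Rightarrow> real"
  assumes w0: "\<And>n. 1 \<le> n \<Longrightarrow> 0 \<le> w n"
    and anti: "\<And>m n. 1 \<le> m \<Longrightarrow> m \<le> n \<Longrightarrow> w n \<le> w m"
    and half: "\<And>n. 1 \<le> n \<Longrightarrow> w (2 * n) \<le> w n / 2"
    and c0: "\<And>l. 1 \<le> l \<Longrightarrow> 0 \<le> c l" and i: "1 \<le> i"
    and sm: "summable (\<lambda>l. w l * c l)"
  shows "summable (\<lambda>j. w (i * 2 ^ j) * (\<Sum>l=1..i * 2 ^ j. c l))" (is "summable ?p")
proof -
  have p0: "0 \<le> ?p j" for j using i by (intro mult_nonneg_nonneg w0 sum_nonneg c0) auto
  \<comment> \<open>The sign hypotheses start at index 1, so the partial sums are bounded by the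
    series shifted by one.\<close>
  have "summable (\<lambda>l. w (Suc l) * c (Suc l))" using sm by (subst summable_Suc_iff)
  then have bound: "(\<Sum>l=1..n. w l * c l) \<le> (\<Sum>l. w (Suc l) * c (Suc l))" for n
    using sum_le_suminf[of "\<lambda>l. w (Suc l) * c (Suc l)" "{..<n}"] w0 c0
    by (simp add: sum.atLeast1_atMost_eq)
  show ?thesis
  proof (rule bounded_imp_summable[OF p0])
    fix J
    show "(\<Sum>j\<le>J. ?p j) \<le> 2 * (\<Sum>l. w (Suc l) * c (Suc l))"
      using dyadic_partial_sums[of w c i J, OF anti half c0 i] p0[of J] bound[of "i * 2 ^ J"] by simp
  qed
qed

text \<open>Sorting the double sum by its larger index turns it into a cumulative sum over l, the
  form that \<open>summable_dyadic\<close> accepts.\<close>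

lemma sum_square_symmetric:
  fixes c :: "nat \<Rightarrow> nat \<Rightarrow> real"
  assumes "\<And>k l. c k l = c l k"
  shows "(\<Sum>k=1..n. \<Sum>l=1..n. c k l) = (\<Sum>l=1..n. c l l + 2 * (\<Sum>k\<in>{1..<l}. c k l))"
proof (induction n)
  case (Suc n)
  have "{1..<Suc n} = {1..n}" by auto
  moreover have "(\<Sum>k=1..n. c (Suc n) k) = (\<Sum>k=1..n. c k (Suc n))"
    by (intro sum.cong refl assms)
  ultimately show ?case using Suc by (simp add: sum.distrib)
qed simp

text \<open>The pathwise form of the Rademacher--Menshov inequality: \<open>k\<close> is approximated by
  its truncated binary expansions \<open>2 ^ s * (k div 2 ^ s)\<close>, whose successive differences are dyadic
  blocks.\<close>

definition dyadic_energy :: "(nat \<Rightarrow> real) \<Rightarrow> nat \<Rightarrow> nat \<Rightarrow> real" where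
  "dyadic_energy S m s = (\<Sum>j<2 ^ (m - s). (S (Suc j * 2 ^ s) - S (j * 2 ^ s))\<^sup>2)"

lemma dyadic_energy_nonneg: "0 \<le> dyadic_energy S m s"
  by (simp add: dyadic_energy_def sum_nonneg)

lemma block_le_dyadic_energy:
  assumes "j < 2 ^ (m - s)"
  shows "\<bar>S (Suc j * 2 ^ s) - S (j * 2 ^ s)\<bar> \<le> sqrt (dyadic_energy S m s)"
proof -
  have "(S (Suc j * 2 ^ s) - S (j * 2 ^ s))\<^sup>2 \<le> dyadic_energy S m s"
    unfolding dyadic_energy_def using assms
    by (intro member_le_sum[where f = "\<lambda>j. (S (Suc j * 2 ^ s) - S (j * 2 ^ s))\<^sup>2"]) auto
  then show ?thesis by (metis real_sqrt_abs real_sqrt_le_iff)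
qed

text \<open>Induction downwards from t = m. Halving q passes to the next coarser truncation of the
  binary expansion; the argument of S changes only when q is odd, and then by a single block of
  length \<open>2 ^ t\<close>.\<close>

lemma abs_le_sum_sqrt_dyadic_energy:
  assumes "S 0 = 0" "t \<le> m" "q \<le> 2 ^ (m - t)"
  shows "\<bar>S (q * 2 ^ t)\<bar> \<le> (\<Sum>s=t..m. sqrt (dyadic_energy S m s))"
  using assms(2,3)
proof (induction arbitrary: q rule: inc_induct)
  case base
  then have "q = 0 \<or> q = 1" by auto
  then show ?case
  proof
    assume "q = 1"
    then show ?thesis using block_le_dyadic_energy[of 0 m m S] assms(1) by simp
  qed (simp add: assms(1) dyadic_energy_nonneg)
next
  case (step t)
  define h where "h = q div 2"
  have pow: "2 ^ (m - t) = 2 * (2 ^ (m - Suc t) :: nat)"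
    using step.hyps by (metis Suc_diff_Suc power_Suc)
  have split: "(\<Sum>s=t..m. sqrt (dyadic_energy S m s)) =
      sqrt (dyadic_energy S m t) + (\<Sum>s=Suc t..m. sqrt (dyadic_energy S m s))"
    using step.hyps by (intro sum.atLeast_Suc_atMost) auto
  have h: "h \<le> 2 ^ (m - Suc t)" using step.prems unfolding h_def pow by linarith
  have IH: "\<bar>S (h * 2 ^ Suc t)\<bar> \<le> (\<Sum>s=Suc t..m. sqrt (dyadic_energy S m s))"
    by (rule step.IH[OF h])
  show ?case
  proof (cases "even q")
    case True
    then have "q * 2 ^ t = h * 2 ^ Suc t" by (auto simp: h_def)
    then show ?thesis
      using IH split real_sqrt_ge_zero[OF dyadic_energy_nonneg[of S m t]]
      by (simp only:)
  next
    case False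
    then have q: "q = Suc (2 * h)" by (simp add: h_def)
    then have "\<bar>S (q * 2 ^ t) - S (h * 2 ^ Suc t)\<bar> \<le> sqrt (dyadic_energy S m t)"
      using block_le_dyadic_energy[of "2 * h" m t S] step.prems by (simp add: mult_ac)
    then show ?thesis using IH split by linarith
  qed
qed

text \<open>Cauchy-Schwarz over the m + 1 levels costs one factor \<open>Suc m\<close>.\<close>

lemma square_le_dyadic_energy:
  assumes "S 0 = 0" "k \<le> 2 ^ m"
  shows "(S k)\<^sup>2 \<le> real (Suc m) * (\<Sum>s\<le>m. dyadic_energy S m s)"
proof -
  have "\<bar>S k\<bar> \<le> (\<Sum>s\<le>m. sqrt (dyadic_energy S m s))"
    using abs_le_sum_sqrt_dyadic_energy[of S 0 m k] assms by (simp add: atLeast0AtMost)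
  then have "(S k)\<^sup>2 \<le> (\<Sum>s\<le>m. sqrt (dyadic_energy S m s))\<^sup>2"
    by (meson abs_ge_zero abs_le_square_iff order_trans abs_ge_self)
  also have "\<dots> \<le> real (card {..m}) * (\<Sum>s\<le>m. (sqrt (dyadic_energy S m s))\<^sup>2)"
    using Cauchy_Schwarz_ineq_sum[of "\<lambda>_. 1" "\<lambda>s. sqrt (dyadic_energy S m s)" "{..m}"] by simp
  finally show ?thesis by (simp add: dyadic_energy_nonneg)
qed

text \<open>The diagonal blocks are part of the full square, and what is left out is nonnegative. In
  the maximal inequality this takes the place of orthogonality.\<close>

lemma sum_blocks_le:
  fixes c :: "nat \<Rightarrow> nat \<Rightarrow> real"
  assumes "\<And>k l. 1 \<le> k \<Longrightarrow> 1 \<le> l \<Longrightarrow> 0 \<le> c k l"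
  shows "(\<Sum>j<J. \<Sum>k\<in>{j * b<..Suc j * b}. \<Sum>l\<in>{j * b<..Suc j * b}. c k l)
    \<le> (\<Sum>k=1..J * b. \<Sum>l=1..J * b. c k l)"
proof (induction J)
  case (Suc J)
  have un: "{1..Suc J * b} = {1..J * b} \<union> {J * b<..Suc J * b}" by auto
  have dis: "{1..J * b} \<inter> {J * b<..Suc J * b} = {}" by auto
  have "(\<Sum>k=1..J * b. \<Sum>l=1..J * b. c k l) \<le> (\<Sum>k=1..J * b. \<Sum>l=1..Suc J * b. c k l)"
    by (intro sum_mono sum_mono2) (auto simp: assms)
  moreover have "(\<Sum>k\<in>{J * b<..Suc J * b}. \<Sum>l\<in>{J * b<..Suc J * b}. c k l)
      \<le> (\<Sum>k\<in>{J * b<..Suc J * b}. \<Sum>l=1..Suc J * b. c k l)"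
    by (intro sum_mono sum_mono2) (auto simp: assms)
  moreover have "(\<Sum>k=1..Suc J * b. \<Sum>l=1..Suc J * b. c k l) =
      (\<Sum>k=1..J * b. \<Sum>l=1..Suc J * b. c k l) + (\<Sum>k\<in>{J * b<..Suc J * b}. \<Sum>l=1..Suc J * b. c k l)"
    by (subst un) (rule sum.union_disjoint, use dis in auto)
  ultimately show ?case using Suc by simp
qed simp

text \<open>Summable expectations make the sum of the series integrable, hence almost surely finite,
  so its terms vanish. This serves in place of Chebyshev's inequality and the Borel-Cantelli
  lemma.\<close>

lemma (in prob_space) AE_tendsto_0_of_summable_expectation:
  fixes f :: "nat \<Rightarrow> 'a \<Rightarrow> real"
  assumes "\<And>j. integrable M (f j)" "\<And>j \<omega>. 0 \<le> f j \<omega>"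
    and sm: "summable (\<lambda>j. expectation (f j))"
  shows "AE \<omega> in M. (\<lambda>j. f j \<omega>) \<longlonglongrightarrow> 0"
proof -
  have [measurable]: "f j \<in> borel_measurable M" for j using assms(1) by auto
  have "(\<integral>\<^sup>+\<omega>. (\<Sum>j. ennreal (f j \<omega>)) \<partial>M) = (\<Sum>j. \<integral>\<^sup>+\<omega>. ennreal (f j \<omega>) \<partial>M)"
    by (rule nn_integral_suminf) measurable
  also have "\<dots> = (\<Sum>j. ennreal (expectation (f j)))"
    using assms by (simp add: nn_integral_eq_integral)
  also have "\<dots> \<noteq> \<infinity>"
    using sm assms by (subst suminf_ennreal2) (auto intro!: integral_nonneg_AE)
  finally have "AE \<omega> in M. (\<Sum>j. ennreal (f j \<omega>)) \<noteq> \<infinity>"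
    by (intro nn_integral_PInf_AE) auto
  then show ?thesis
    by eventually_elim (use assms in \<open>auto intro!: summable_LIMSEQ_zero summable_suminf_not_top\<close>)
qed

section \<open>Identically distributed pairwise PQD sequences\<close>

text \<open>For the least j with \<open>y \<le> z * 2 ^ Suc j\<close>, either j = 0 or y exceeds
  \<open>z * 2 ^ j\<close>, so this one summand already dominates the left side. The cutoff J keeps
  the sum finite.\<close>

lemma min_one_powr_le_layers:
  fixes z p :: real
  assumes "0 < z" "1 < p" "0 < y" "y \<le> z * 2 ^ Suc J"
  shows "min 1 (z / y) powr p \<le> (\<Sum>j\<le>J. of_bool (y \<le> z * 2 ^ Suc j) * (1 / 2 powr p) ^ j)"
proof -
  define j where "j = (LEAST j. y \<le> z * 2 ^ Suc j)"
  have j: "y \<le> z * 2 ^ Suc j" unfolding j_def by (rule LeastI[of _ J]) (rule assms)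
  have "j \<le> J" unfolding j_def by (rule Least_le) (rule assms)
  have "min 1 (z / y) \<le> 1 / 2 ^ j"
  proof (cases j)
    case (Suc i)
    have "\<not> y \<le> z * 2 ^ Suc i"
      using not_less_Least[of i "\<lambda>j. y \<le> z * 2 ^ Suc j"] Suc unfolding j_def by simp
    then show ?thesis using Suc assms by (simp add: field_simps min_le_iff_disj)
  qed simp
  then have "min 1 (z / y) powr p \<le> (1 / 2 ^ j) powr p"
    using assms by (intro powr_mono2) auto
  also have "\<dots> = of_bool (y \<le> z * 2 ^ Suc j) * (1 / 2 powr p) ^ j"
  proof -
    have "(2 ^ j) powr p = (2 powr p) ^ j"
      by (simp add: powr_realpow[symmetric] powr_powr mult.commute)
    then show ?thesis using j by (simp add: powr_divide power_divide)
  qed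
  also have "\<dots> \<le> (\<Sum>j\<le>J. of_bool (y \<le> z * 2 ^ Suc j) * (1 / 2 powr p) ^ j)"
    using \<open>j \<le> J\<close> by (intro member_le_sum[where f = "\<lambda>j. of_bool (y \<le> z * 2 ^ Suc j) * (1 / 2 powr p) ^ j"]) auto
  finally show ?thesis .
qed

text \<open>The weights are controlled only on average, so terms are counted by layers: the weights
  up to \<open>z * 2 ^ Suc j\<close> total at most \<open>C * z * 2 ^ Suc j\<close>, against a
  factor \<open>(1 / 2 powr p) ^ j\<close>. The resulting geometric ratio is below 1 exactly because
  p > 1.\<close>

lemma sum_min_one_powr_le:
  fixes b :: "nat \<Rightarrow> real" and z p :: real
  assumes b0: "\<And>l. 0 \<le> b l" and b: "\<And>n. (\<Sum>l=1..n. b l) \<le> C * real n"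
    and "1 < p" "0 \<le> z"
  shows "(\<Sum>l=1..n. b l * min 1 (z / real l) powr p) \<le> 2 * C / (1 - 2 / 2 powr p) * z"
proof (cases "z = 0")
  case False
  then have z: "0 < z" using assms by simp
  have C: "0 \<le> C" using b[of 1] b0[of 1] by simp
  have q: "2 / 2 powr p < (1::real)" using powr_less_mono[of 1 p "2::real"] assms by simp
  \<comment> \<open>Large enough that every index up to n falls into some layer; the final bound
    does not depend on J.\<close>
  obtain J :: nat where J: "real n / z < 2 ^ J" using real_arch_pow[of 2 "real n / z"] by auto
  have nJ: "real n \<le> z * 2 ^ Suc J"
  proof -
    have "real n < z * 2 ^ J" using J z by (simp add: field_simps)
    also have "\<dots> \<le> z * 2 ^ Suc J" using z by simp
    finally show ?thesis by simp
  qed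
  have partial: "(\<Sum>l=1..n. b l * of_bool (real l \<le> y)) \<le> C * y" if "0 \<le> y" for y
  proof -
    have "(\<Sum>l=1..n. b l * of_bool (real l \<le> y)) = (\<Sum>l\<in>{l\<in>{1..n}. real l \<le> y}. b l)"
      by (simp add: of_bool_def if_distrib sum.inter_filter[symmetric] cong: if_cong)
    also have "\<dots> \<le> (\<Sum>l=1..nat \<lfloor>y\<rfloor>. b l)"
      by (intro sum_mono2) (auto simp: b0 le_nat_floor)
    also have "\<dots> \<le> C * real (nat \<lfloor>y\<rfloor>)" by (rule b)
    also have "\<dots> \<le> C * y" using that C by (intro mult_left_mono) linarith+
    finally show ?thesis .
  qed
  have "(\<Sum>l=1..n. b l * min 1 (z / real l) powr p)
      \<le> (\<Sum>l=1..n. b l * (\<Sum>j\<le>J. of_bool (real l \<le> z * 2 ^ Suc j) * (1 / 2 powr p) ^ j))"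
    using nJ by (intro sum_mono mult_left_mono b0 min_one_powr_le_layers z assms) auto
  also have "\<dots> = (\<Sum>j\<le>J. (1 / 2 powr p) ^ j * (\<Sum>l=1..n. b l * of_bool (real l \<le> z * 2 ^ Suc j)))"
    unfolding sum_distrib_left by (subst sum.swap) (simp add: mult_ac)
  also have "\<dots> \<le> (\<Sum>j\<le>J. (1 / 2 powr p) ^ j * (C * (z * 2 ^ Suc j)))"
    using z by (intro sum_mono mult_left_mono partial) auto
  also have "\<dots> = 2 * C * z * (\<Sum>j\<le>J. (2 / 2 powr p) ^ j)"
    by (simp add: sum_distrib_left power_divide mult_ac)
  also have "\<dots> \<le> 2 * C * z * (1 / (1 - 2 / 2 powr p))"
  proof (intro mult_left_mono)
    show "(\<Sum>j\<le>J. (2 / 2 powr p) ^ j) \<le> 1 / (1 - 2 / 2 powr p)"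
      using q sum_le_suminf[OF summable_geometric[of "2 / 2 powr p"], of "{..J}"]
      by (simp add: suminf_geometric)
  qed (use C z in auto)
  finally show ?thesis by (simp add: mult_ac)
qed simp

locale pqd_sequence = prob_space M for M :: "'a measure" +
  fixes eps :: "nat \<Rightarrow> 'a \<Rightarrow> real" and r :: real
  assumes meas [measurable]: "\<And>k. eps k \<in> borel_measurable M"
    and ident: "\<And>k. 1 \<le> k \<Longrightarrow> distr M borel (eps k) = distr M borel (eps 1)"
    and pairwise_pqd: "pairwise_PQD M eps"
    and r_range: "1 \<le> r" "r < 2"
    and moment: "integrable M (\<lambda>\<omega>. \<bar>eps 1 \<omega>\<bar> powr r)"
begin

text \<open>For k = l, which \<open>pairwise_PQD\<close> leaves out, the joint event is the smaller
  of two nested events. Variances are thereby covered by the covariance lemmas.\<close>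

lemma pqd_eps:
  assumes "1 \<le> k" "1 \<le> l"
  shows "pqd (eps k) (eps l)"
proof (cases "k = l")
  case True
  have "prob {\<omega> \<in> space M. eps k \<omega> \<le> x} * prob {\<omega> \<in> space M. eps k \<omega> \<le> y}
      \<le> prob {\<omega> \<in> space M. eps k \<omega> \<le> x \<and> eps k \<omega> \<le> y}" for x y
  proof (cases "x \<le> y")
    case True
    then have "{\<omega> \<in> space M. eps k \<omega> \<le> x \<and> eps k \<omega> \<le> y} = {\<omega> \<in> space M. eps k \<omega> \<le> x}" by auto
    then show ?thesis by (simp add: mult_left_le)
  next
    case False
    then have "{\<omega> \<in> space M. eps k \<omega> \<le> x \<and> eps k \<omega> \<le> y} = {\<omega> \<in> space M. eps k \<omega> \<le> y}" by auto
    then show ?thesis by (simp add: mult_left_le_one_le)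
  qed
  then show ?thesis using True by (simp add: pqd_def)
next
  case False
  then show ?thesis using pairwise_pqd assms by (auto simp: pairwise_PQD_def pqd_def)
qed

lemma expectation_eps:
  fixes f :: "real \<Rightarrow> real"
  assumes "1 \<le> k" and [measurable]: "f \<in> borel_measurable borel"
  shows "expectation (\<lambda>\<omega>. f (eps k \<omega>)) = expectation (\<lambda>\<omega>. f (eps 1 \<omega>))"
  using integral_distr[of "eps k" M borel f] integral_distr[of "eps 1" M borel f] ident[OF assms(1)]
  by simp

lemma integrable_eps:
  fixes f :: "real \<Rightarrow> real"
  assumes "1 \<le> k" and [measurable]: "f \<in> borel_measurable borel"
  shows "integrable M (\<lambda>\<omega>. f (eps k \<omega>)) \<longleftrightarrow> integrable M (\<lambda>\<omega>. f (eps 1 \<omega>))"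
  using integrable_distr_eq[of "eps k" M borel f] integrable_distr_eq[of "eps 1" M borel f]
    ident[OF assms(1)] by simp

text \<open>This is min(1, |y| / l^(1/r))^2, the squared size of y relative to the truncation level.
  It is written through |y|^r so that \<open>sum_min_one_powr_le\<close> applies with z = |y|^r and
  exponent 2 / r > 1. Its series controls both the truncation error and the variances of the
  clips.\<close>

abbreviation rel_size :: "nat \<Rightarrow> real \<Rightarrow> real" where
  "rel_size l y \<equiv> min 1 (\<bar>y\<bar> powr r / real l) powr (2 / r)"

lemma integrable_rel_size: "integrable M (\<lambda>\<omega>. rel_size l (eps k \<omega>))"
  by (rule integrable_const_bound[where B = 1]) (use r_range in \<open>auto intro!: powr_le1\<close>)

text \<open>For a fixed value y the weighted sum of relative sizes is at most a constant times
  |y|^r, uniformly in n, and the moment hypothesis integrates this bound. Identical distribution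
  lets every term be evaluated at \<open>eps 1\<close>.\<close>

lemma summable_rel_size:
  assumes b0: "\<And>l. 0 \<le> b l" and b: "\<And>n. (\<Sum>l=1..n. b l) \<le> C * real n"
  shows "summable (\<lambda>l. b l * expectation (\<lambda>\<omega>. rel_size l (eps l \<omega>)))"
proof -
  let ?e = "\<lambda>l. expectation (\<lambda>\<omega>. rel_size l (eps 1 \<omega>))"
  let ?K = "2 * C / (1 - 2 / 2 powr (2 / r))"
  have e0: "0 \<le> ?e l" for l by (intro integral_nonneg_AE) auto
  have "(\<Sum>l=1..n. b l * ?e l) \<le> ?K * expectation (\<lambda>\<omega>. \<bar>eps 1 \<omega>\<bar> powr r)" for n
  proof -
    have "(\<Sum>l=1..n. b l * ?e l) = expectation (\<lambda>\<omega>. \<Sum>l=1..n. b l * rel_size l (eps 1 \<omega>))"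
      by (subst Bochner_Integration.integral_sum) (auto intro: integrable_mult_right integrable_rel_size)
    also have "\<dots> \<le> expectation (\<lambda>\<omega>. ?K * \<bar>eps 1 \<omega>\<bar> powr r)"
      by (intro integral_mono Bochner_Integration.integrable_sum integrable_mult_right
          integrable_rel_size moment sum_min_one_powr_le b0 b) (use r_range in auto)
    finally show ?thesis using moment by simp
  qed
  then have "summable (\<lambda>l. b (Suc l) * ?e (Suc l))"
    by (intro bounded_imp_summable[where B = "?K * expectation (\<lambda>\<omega>. \<bar>eps 1 \<omega>\<bar> powr r)"])
      (auto simp: b0 e0 sum.atLeast1_atMost_eq lessThan_Suc_atMost[symmetric] simp del: sum.lessThan_Suc)
  moreover have "expectation (\<lambda>\<omega>. rel_size (Suc l) (eps (Suc l) \<omega>)) = ?e (Suc l)" for l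
    by (rule expectation_eps[of _ "rel_size (Suc l)"]) auto
  ultimately show ?thesis by (subst summable_Suc_iff[symmetric]) simp
qed

text \<open>With unit weights the relative sizes tend to 0 almost surely, and a value below 1 means
  |eps l|^r < l.\<close>

lemma AE_eventually_abs_eps_le: "AE \<omega> in M. \<forall>\<^sub>F l in sequentially. \<bar>eps l \<omega>\<bar> \<le> real l powr (1 / r)"
proof -
  have "summable (\<lambda>l. expectation (\<lambda>\<omega>. rel_size l (eps l \<omega>)))"
    using summable_rel_size[of "\<lambda>_. 1" 1] by simp
  then have "AE \<omega> in M. (\<lambda>l. rel_size l (eps l \<omega>)) \<longlonglongrightarrow> 0"
    by (intro AE_tendsto_0_of_summable_expectation integrable_rel_size) auto
  then show ?thesis
  proof eventually_elim
    case (elim \<omega>)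
    then have "\<forall>\<^sub>F l in sequentially. rel_size l (eps l \<omega>) < 1"
      by (rule order_tendstoD) simp
    then show ?case using eventually_gt_at_top[of 0]
    proof eventually_elim
      case (elim l)
      then have "\<bar>eps l \<omega>\<bar> powr r / real l < 1"
        by (auto simp: min_def split: if_splits)
      then have "\<bar>eps l \<omega>\<bar> powr r \<le> real l" using elim by simp
      then have "(\<bar>eps l \<omega>\<bar> powr r) powr (1 / r) \<le> real l powr (1 / r)"
        using r_range by (intro powr_mono2) auto
      then show ?case using r_range by (simp add: powr_powr)
    qed
  qed
qed

text \<open>With L = l^(1/r) the clip is at most min(L, |y|) in modulus, and
  \<open>rel_size l y\<close> is the square of min(1, |y| / L).\<close>

lemma clip_square_le_rel_size:
  assumes "1 \<le> l" "0 \<le> s" "s \<le> real l powr (1 / r)"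
  shows "real l powr (- 2 / r) * (clip (- s) s y)\<^sup>2 \<le> rel_size l y"
proof -
  let ?L = "real l powr (1 / r)"
  have L: "0 < ?L" using assms by simp
  have "\<bar>clip (- s) s y\<bar> \<le> min ?L \<bar>y\<bar>" using assms(2,3) by (auto simp: clip_def)
  then have "(clip (- s) s y)\<^sup>2 \<le> (min ?L \<bar>y\<bar>)\<^sup>2" by (metis abs_ge_zero power2_abs power_mono)
  then have "(1 / ?L)\<^sup>2 * (clip (- s) s y)\<^sup>2 \<le> (1 / ?L)\<^sup>2 * (min ?L \<bar>y\<bar>)\<^sup>2"
    by (intro mult_left_mono) auto
  also have "(1 / ?L)\<^sup>2 * (min ?L \<bar>y\<bar>)\<^sup>2 = (min 1 (\<bar>y\<bar> / ?L))\<^sup>2"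
  proof -
    have "1 / ?L * min ?L \<bar>y\<bar> = min 1 (\<bar>y\<bar> / ?L)"
      using L by (auto simp: min_def field_simps)
    then show ?thesis by (simp only: power_mult_distrib[symmetric])
  qed
  also have "min 1 (\<bar>y\<bar> / ?L) = min 1 (\<bar>y\<bar> powr r / real l) powr (1 / r)"
  proof -
    have "min 1 (\<bar>y\<bar> powr r / real l) powr (1 / r) = min 1 ((\<bar>y\<bar> powr r / real l) powr (1 / r))"
    proof (cases "\<bar>y\<bar> powr r / real l \<le> 1")
      case True
      then have "(\<bar>y\<bar> powr r / real l) powr (1 / r) \<le> 1" using r_range by (intro powr_le1) auto
      then show ?thesis using True by simp
    next
      case False
      then have "1 \<le> (\<bar>y\<bar> powr r / real l) powr (1 / r)" using r_range by (intro ge_one_powr_ge_zero) auto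
      then show ?thesis using False by simp
    qed
    then show ?thesis using r_range by (simp add: powr_divide powr_powr)
  qed
  also have "\<dots>\<^sup>2 = rel_size l y"
    by (simp add: powr_realpow'[symmetric] power2_eq_square powr_add[symmetric] del: min_less_iff_conj)
  moreover have "real l powr (- 2 / r) = (1 / ?L)\<^sup>2"
    by (simp add: powr_minus_divide power_divide power2_eq_square powr_add[symmetric])
  ultimately show ?thesis by simp
qed

end

section \<open>Weighted sums of clipped variables\<close>

context pqd_sequence
begin

definition clipped :: "(nat \<Rightarrow> real) \<Rightarrow> (nat \<Rightarrow> real) \<Rightarrow> nat \<Rightarrow> 'a \<Rightarrow> real" where
  "clipped u v k \<omega> = clip (u k) (v k) (eps k \<omega>)"

definition clip_sum :: "(nat \<Rightarrow> real) \<Rightarrow> (nat \<Rightarrow> real) \<Rightarrow> (nat \<Rightarrow> real) \<Rightarrow> nat \<Rightarrow> 'a \<Rightarrow> real" where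
  "clip_sum a u v n \<omega> = (\<Sum>k=1..n. a k * (clipped u v k \<omega> - expectation (clipped u v k)))"

definition clip_cov :: "(nat \<Rightarrow> real) \<Rightarrow> (nat \<Rightarrow> real) \<Rightarrow> (nat \<Rightarrow> real) \<Rightarrow> nat \<Rightarrow> nat \<Rightarrow> real" where
  "clip_cov a u v k l = a k * a l * cov M (clipped u v k) (clipped u v l)"

text \<open>\<open>\<sigma>\<close> is the envelope of the clips, and w is the inverse of a squared
  norming, up to logarithms; its halving property reflects 2 / r > 1. The truncation schemes below
  are instances, with w equal to n^(-2/r) or to that divided by the square of
  \<open>damp n\<close>.\<close>

context
  fixes a u v \<sigma> w :: "nat \<Rightarrow> real" and C :: real
  assumes a0: "\<And>k. 0 \<le> a k"
    and a2: "\<And>n. (\<Sum>k=1..n. (a k)\<^sup>2) \<le> C * real n"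
    and w0: "\<And>n. 1 \<le> n \<Longrightarrow> 0 \<le> w n"
    and w_le: "\<And>n. 1 \<le> n \<Longrightarrow> w n \<le> real n powr (- 2 / r)"
    and w_anti: "\<And>m n. 1 \<le> m \<Longrightarrow> m \<le> n \<Longrightarrow> w n \<le> w m"
    and w_half: "\<And>n. 1 \<le> n \<Longrightarrow> w (2 * n) \<le> w n / 2"
    and \<sigma>0: "\<And>n. 1 \<le> n \<Longrightarrow> 0 \<le> \<sigma> n"
    and \<sigma>_le: "\<And>n. 1 \<le> n \<Longrightarrow> \<sigma> n \<le> real n powr (1 / r)"
    and \<sigma>_mono: "\<And>m n. 1 \<le> m \<Longrightarrow> m \<le> n \<Longrightarrow> \<sigma> m \<le> \<sigma> n"
    and uv: "\<And>n. 1 \<le> n \<Longrightarrow> - \<sigma> n \<le> u n \<and> u n \<le> v n \<and> v n \<le> \<sigma> n"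
    and G: "summable (\<lambda>l. w l * (\<Sum>k\<in>{1..<l}. a k * a l * G_cov M (eps k) (eps l) (\<sigma> l)))"
begin

lemma clip_cov_commute: "clip_cov a u v k l = clip_cov a u v l k"
  by (simp add: clip_cov_def cov_commute[of M "clipped u v k"] mult_ac)

lemma clip_cov_nonneg: "1 \<le> k \<Longrightarrow> 1 \<le> l \<Longrightarrow> 0 \<le> clip_cov a u v k l"
  unfolding clip_cov_def clipped_def using uv[of k] uv[of l]
  by (intro mult_nonneg_nonneg a0 cov_clip_nonneg pqd_eps) auto

text \<open>Both clips are widened to the envelope of the larger index l, which contains that of k
  because \<open>\<sigma>\<close> is monotone.\<close>

lemma clip_cov_le_G:
  assumes "1 \<le> k" "k \<le> l"
  shows "clip_cov a u v k l \<le> a k * a l * G_cov M (eps k) (eps l) (\<sigma> l)"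
proof -
  have "cov M (clipped u v k) (clipped u v l) \<le> G_cov M (eps k) (eps l) (\<sigma> l)"
    unfolding clipped_def using assms uv[of k] uv[of l] \<sigma>_mono[of k l] \<sigma>0[of l]
    by (subst G_cov_eq_cov) (auto intro!: cov_clip_mono pqd_eps)
  then show ?thesis unfolding clip_cov_def by (intro mult_left_mono mult_nonneg_nonneg a0)
qed

text \<open>The summability condition on \<open>G_cov\<close> concerns k < l, so the diagonal is
  paid for by the moment: the variance is at most the second moment of the clip to the envelope,
  which \<open>rel_size\<close> bounds after weighting.\<close>

lemma clip_cov_diag_le:
  assumes "1 \<le> l"
  shows "w l * clip_cov a u v l l \<le> (a l)\<^sup>2 * expectation (\<lambda>\<omega>. rel_size l (eps l \<omega>))"
proof -
  have int: "integrable M (\<lambda>\<omega>. (clip (- \<sigma> l) (\<sigma> l) (eps l \<omega>))\<^sup>2)"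
    unfolding power2_eq_square using \<sigma>0[OF assms] by simp
  have "clip_cov a u v l l \<le> (a l)\<^sup>2 * expectation (\<lambda>\<omega>. (clip (- \<sigma> l) (\<sigma> l) (eps l \<omega>))\<^sup>2)"
    using clip_cov_le_G[of l l] assms \<sigma>0[OF assms] mult_left_mono[of "G_cov M (eps l) (eps l) (\<sigma> l)"
      "expectation (\<lambda>\<omega>. (clip (- \<sigma> l) (\<sigma> l) (eps l \<omega>))\<^sup>2)" "(a l)\<^sup>2"]
    by (simp add: G_cov_eq_cov cov_def power2_eq_square)
  then have "w l * clip_cov a u v l l \<le>
      real l powr (- 2 / r) * ((a l)\<^sup>2 * expectation (\<lambda>\<omega>. (clip (- \<sigma> l) (\<sigma> l) (eps l \<omega>))\<^sup>2))"
    using clip_cov_nonneg[of l l] w_le[of l] w0[of l] assms by (intro mult_mono) auto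
  also have "\<dots> = (a l)\<^sup>2 *
      expectation (\<lambda>\<omega>. real l powr (- 2 / r) * (clip (- \<sigma> l) (\<sigma> l) (eps l \<omega>))\<^sup>2)"
    by simp
  also have "\<dots> \<le> (a l)\<^sup>2 * expectation (\<lambda>\<omega>. rel_size l (eps l \<omega>))"
    using int assms \<sigma>0[of l] \<sigma>_le[of l]
    by (intro mult_left_mono integral_mono integrable_mult_right integrable_rel_size
        clip_square_le_rel_size) auto
  finally show ?thesis .
qed

lemma summable_clip_cov: "summable (\<lambda>l. w l * (clip_cov a u v l l + 2 * (\<Sum>k\<in>{1..<l}. clip_cov a u v k l)))"
proof (rule summable_comparison_test'[where N = 1])
  show "summable (\<lambda>l. (a l)\<^sup>2 * expectation (\<lambda>\<omega>. rel_size l (eps l \<omega>)) +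
      2 * (w l * (\<Sum>k\<in>{1..<l}. a k * a l * G_cov M (eps k) (eps l) (\<sigma> l))))"
    using summable_rel_size[of "\<lambda>l. (a l)\<^sup>2" C] a2 G by (intro summable_add summable_mult) auto
  fix l :: nat assume l: "1 \<le> l"
  have "(\<Sum>k\<in>{1..<l}. clip_cov a u v k l) \<le> (\<Sum>k\<in>{1..<l}. a k * a l * G_cov M (eps k) (eps l) (\<sigma> l))"
    by (intro sum_mono clip_cov_le_G) auto
  then have "w l * (\<Sum>k\<in>{1..<l}. clip_cov a u v k l)
      \<le> w l * (\<Sum>k\<in>{1..<l}. a k * a l * G_cov M (eps k) (eps l) (\<sigma> l))"
    by (intro mult_left_mono w0 l)
  moreover have "0 \<le> w l * (clip_cov a u v l l + 2 * (\<Sum>k\<in>{1..<l}. clip_cov a u v k l))"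
    by (intro mult_nonneg_nonneg add_nonneg_nonneg sum_nonneg w0 l clip_cov_nonneg) (use l in auto)
  ultimately show "norm (w l * (clip_cov a u v l l + 2 * (\<Sum>k\<in>{1..<l}. clip_cov a u v k l))) \<le>
      (a l)\<^sup>2 * expectation (\<lambda>\<omega>. rel_size l (eps l \<omega>)) +
      2 * (w l * (\<Sum>k\<in>{1..<l}. a k * a l * G_cov M (eps k) (eps l) (\<sigma> l)))"
    using clip_cov_diag_le[OF l] by (simp add: algebra_simps)
qed

lemma summable_dyadic_clip_cov:
  assumes "1 \<le> i"
  shows "summable (\<lambda>j. w (i * 2 ^ j) * (\<Sum>k=1..i * 2 ^ j. \<Sum>l=1..i * 2 ^ j. clip_cov a u v k l))"
  unfolding sum_square_symmetric[of "clip_cov a u v", OF clip_cov_commute]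
  using w0 w_anti w_half assms summable_clip_cov
  by (intro summable_dyadic) (auto intro!: add_nonneg_nonneg sum_nonneg clip_cov_nonneg)

lemma block_second_moment:
  assumes "I \<subseteq> {1..}" "finite I"
  shows "integrable M (\<lambda>\<omega>. (\<Sum>k\<in>I. a k * (clipped u v k \<omega> - expectation (clipped u v k)))\<^sup>2)"
    and "expectation (\<lambda>\<omega>. (\<Sum>k\<in>I. a k * (clipped u v k \<omega> - expectation (clipped u v k)))\<^sup>2) = (\<Sum>k\<in>I. \<Sum>l\<in>I. clip_cov a u v k l)"
proof -
  have "u k \<le> v k" if "k \<in> I" for k using uv[of k] that assms by auto
  then have "integrable M (clipped u v k)" "integrable M (\<lambda>\<omega>. clipped u v k \<omega> * clipped u v l \<omega>)" if "k \<in> I" "l \<in> I" for k l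
    using that by (auto simp: clipped_def[abs_def])
  from expectation_centered_sum_square[OF assms(2) this, where a = a]
  show "integrable M (\<lambda>\<omega>. (\<Sum>k\<in>I. a k * (clipped u v k \<omega> - expectation (clipped u v k)))\<^sup>2)"
    "expectation (\<lambda>\<omega>. (\<Sum>k\<in>I. a k * (clipped u v k \<omega> - expectation (clipped u v k)))\<^sup>2) = (\<Sum>k\<in>I. \<Sum>l\<in>I. clip_cov a u v k l)"
    by (auto simp: clip_cov_def)
qed

lemma AE_dyadic_tendsto_0:
  assumes "1 \<le> i"
  shows "AE \<omega> in M. (\<lambda>j. w (i * 2 ^ j) * (clip_sum a u v (i * 2 ^ j) \<omega>)\<^sup>2) \<longlonglongrightarrow> 0"
proof (rule AE_tendsto_0_of_summable_expectation)
  show "integrable M (\<lambda>\<omega>. w (i * 2 ^ j) * (clip_sum a u v (i * 2 ^ j) \<omega>)\<^sup>2)" for j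
    unfolding clip_sum_def by (intro integrable_mult_right block_second_moment) auto
  show "0 \<le> w (i * 2 ^ j) * (clip_sum a u v (i * 2 ^ j) \<omega>)\<^sup>2" for j \<omega>
    using w0[of "i * 2 ^ j"] assms by simp
  have "expectation (\<lambda>\<omega>. (clip_sum a u v (i * 2 ^ j) \<omega>)\<^sup>2) = (\<Sum>k=1..i * 2 ^ j. \<Sum>l=1..i * 2 ^ j. clip_cov a u v k l)" for j
    unfolding clip_sum_def by (rule block_second_moment) auto
  then show "summable (\<lambda>j. expectation (\<lambda>\<omega>. w (i * 2 ^ j) * (clip_sum a u v (i * 2 ^ j) \<omega>)\<^sup>2))"
    using summable_dyadic_clip_cov[OF assms] by simp
qed

text \<open>The second moments of the block increments are the diagonal blocks of the covariance
  square, so \<open>sum_blocks_le\<close> gives the same bound for every level s.\<close>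

lemma dyadic_energy_expectation:
  assumes "s \<le> m"
  shows "integrable M (\<lambda>\<omega>. dyadic_energy (\<lambda>n. clip_sum a u v n \<omega>) m s)"
    and "expectation (\<lambda>\<omega>. dyadic_energy (\<lambda>n. clip_sum a u v n \<omega>) m s) \<le> (\<Sum>k=1..2 ^ m. \<Sum>l=1..2 ^ m. clip_cov a u v k l)"
proof -
  let ?I = "\<lambda>j::nat. {j * 2 ^ s<..Suc j * 2 ^ s}"
  have clip_sum_diff: "clip_sum a u v (Suc j * 2 ^ s) \<omega> - clip_sum a u v (j * 2 ^ s) \<omega> = (\<Sum>k\<in>?I j. a k * (clipped u v k \<omega> - expectation (clipped u v k)))"
    for j \<omega>
  proof -
    have "{1..Suc j * 2 ^ s} = {1..j * 2 ^ s} \<union> ?I j" by auto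
    moreover have "{1..j * 2 ^ s} \<inter> ?I j = {}" by auto
    ultimately have "clip_sum a u v (Suc j * 2 ^ s) \<omega> = clip_sum a u v (j * 2 ^ s) \<omega> + (\<Sum>k\<in>?I j. a k * (clipped u v k \<omega> - expectation (clipped u v k)))"
      unfolding clip_sum_def by (simp only: sum.union_disjoint finite_atLeastAtMost finite_greaterThanAtMost)
    then show ?thesis by simp
  qed
  have int: "integrable M (\<lambda>\<omega>. (clip_sum a u v (Suc j * 2 ^ s) \<omega> - clip_sum a u v (j * 2 ^ s) \<omega>)\<^sup>2)" for j
    unfolding clip_sum_diff by (rule block_second_moment) auto
  then show "integrable M (\<lambda>\<omega>. dyadic_energy (\<lambda>n. clip_sum a u v n \<omega>) m s)"
    unfolding dyadic_energy_def by (intro Bochner_Integration.integrable_sum)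
  have "expectation (\<lambda>\<omega>. dyadic_energy (\<lambda>n. clip_sum a u v n \<omega>) m s) =
      (\<Sum>j<2 ^ (m - s). expectation (\<lambda>\<omega>. (clip_sum a u v (Suc j * 2 ^ s) \<omega> - clip_sum a u v (j * 2 ^ s) \<omega>)\<^sup>2))"
    unfolding dyadic_energy_def by (intro Bochner_Integration.integral_sum int)
  also have "\<dots> = (\<Sum>j<2 ^ (m - s). \<Sum>k\<in>?I j. \<Sum>l\<in>?I j. clip_cov a u v k l)"
    unfolding clip_sum_diff by (intro sum.cong refl block_second_moment) auto
  also have "\<dots> \<le> (\<Sum>k=1..2 ^ (m - s) * 2 ^ s. \<Sum>l=1..2 ^ (m - s) * 2 ^ s. clip_cov a u v k l)"
    by (rule sum_blocks_le) (rule clip_cov_nonneg)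
  finally show "expectation (\<lambda>\<omega>. dyadic_energy (\<lambda>n. clip_sum a u v n \<omega>) m s) \<le> (\<Sum>k=1..2 ^ m. \<Sum>l=1..2 ^ m. clip_cov a u v k l)"
    using assms by (simp add: power_add[symmetric])
qed

text \<open>A null sequence g depending on the path replaces a running maximum over n. One factor
  \<open>Suc m\<close> comes from Cauchy-Schwarz, the other from the number of levels.\<close>

lemma AE_max_tendsto_0:
  "AE \<omega> in M. \<exists>g. g \<longlonglongrightarrow> 0 \<and> (\<forall>m n. n \<le> 2 ^ m \<longrightarrow> w (2 ^ m) * (clip_sum a u v n \<omega>)\<^sup>2 \<le> (real (Suc m))\<^sup>2 * g m)"
proof -
  let ?V = "\<lambda>m. (\<Sum>k=1..2 ^ m. \<Sum>l=1..2 ^ m. clip_cov a u v k l)"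
  let ?E = "\<lambda>m \<omega>. (\<Sum>s\<le>m. dyadic_energy (\<lambda>n. clip_sum a u v n \<omega>) m s)"
  \<comment> \<open>Dividing by the number of levels leaves at most one full covariance square in
    the expectation.\<close>
  let ?g = "\<lambda>m \<omega>. w (2 ^ m) * (?E m \<omega> / real (Suc m))"
  have int: "integrable M (?g m)" for m
    by (intro integrable_mult_right integrable_divide Bochner_Integration.integrable_sum
        dyadic_energy_expectation) auto
  have le: "expectation (?g m) \<le> w (1 * 2 ^ m) * ?V m" for m
  proof -
    have "expectation (?E m) = (\<Sum>s\<le>m. expectation (\<lambda>\<omega>. dyadic_energy (\<lambda>n. clip_sum a u v n \<omega>) m s))"
      by (intro Bochner_Integration.integral_sum dyadic_energy_expectation) auto
    also have "\<dots> \<le> (\<Sum>s\<le>m. ?V m)"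
      by (intro sum_mono dyadic_energy_expectation) auto
    finally have "expectation (?E m) \<le> (\<Sum>s\<le>m. ?V m)" .
    then have "expectation (?E m) / real (Suc m) \<le> ?V m" by (simp add: field_simps)
    then have "w (2 ^ m) * (expectation (?E m) / real (Suc m)) \<le> w (2 ^ m) * ?V m"
      by (intro mult_left_mono w0) auto
    moreover have "expectation (?g m) = w (2 ^ m) * (expectation (?E m) / real (Suc m))" by simp
    ultimately show ?thesis by simp
  qed
  have g0: "0 \<le> ?g m \<omega>" for m \<omega>
    by (intro mult_nonneg_nonneg divide_nonneg_nonneg w0 sum_nonneg dyadic_energy_nonneg) auto
  have "AE \<omega> in M. (\<lambda>m. ?g m \<omega>) \<longlonglongrightarrow> 0"
  proof (rule AE_tendsto_0_of_summable_expectation[OF int g0])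
    show "summable (\<lambda>m. expectation (?g m))"
    proof (rule summable_comparison_test'[where N = 0])
      show "summable (\<lambda>m. w (1 * 2 ^ m) * ?V m)" using summable_dyadic_clip_cov[of 1] by simp
      show "norm (expectation (?g m)) \<le> w (1 * 2 ^ m) * ?V m" for m
        using le[of m] integral_nonneg_AE[where f = "?g m" and M = M] g0 by simp
    qed
  qed
  then show ?thesis
  proof eventually_elim
    case (elim \<omega>)
    show ?case
    proof (intro exI[of _ "\<lambda>m. ?g m \<omega>"] conjI allI impI elim)
      fix m n :: nat assume "n \<le> 2 ^ m"
      then have "(clip_sum a u v n \<omega>)\<^sup>2 \<le> real (Suc m) * ?E m \<omega>"
        by (intro square_le_dyadic_energy) (auto simp: clip_sum_def)
      then have "w (2 ^ m) * (clip_sum a u v n \<omega>)\<^sup>2 \<le> w (2 ^ m) * (real (Suc m) * ?E m \<omega>)"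
        by (intro mult_left_mono w0) auto
      also have "\<dots> = (real (Suc m))\<^sup>2 * ?g m \<omega>"
        by (simp add: power2_eq_square del: of_nat_Suc)
      finally show "w (2 ^ m) * (clip_sum a u v n \<omega>)\<^sup>2 \<le> (real (Suc m))\<^sup>2 * ?g m \<omega>" .
    qed
  qed
qed

end

end

section \<open>Deterministic limit lemmas\<close>

lemma tendsto_0_of_dyadic_bound:
  fixes f g :: "nat \<Rightarrow> real"
  assumes g: "g \<longlonglongrightarrow> 0"
    and le: "\<And>m n. 2 ^ m \<le> n \<Longrightarrow> n < 2 ^ Suc m \<Longrightarrow> \<bar>f n\<bar> \<le> g m"
  shows "f \<longlonglongrightarrow> 0"
proof (rule LIMSEQ_I)
  fix \<delta> :: real assume "0 < \<delta>"
  then obtain M where M: "\<And>m. M \<le> m \<Longrightarrow> \<bar>g m\<bar> < \<delta>"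
    using LIMSEQ_D[OF g] by auto
  show "\<exists>no. \<forall>n\<ge>no. norm (f n - 0) < \<delta>"
  proof (intro exI[of _ "2 ^ M"] allI impI)
    fix n :: nat assume n: "2 ^ M \<le> n"
    then have "1 \<le> n" using order_trans[OF one_le_power[of "2::nat" M]] by simp
    then obtain m where m: "2 ^ m \<le> n" "n < 2 ^ Suc m"
      using ex_power_ivl1[of 2 n] by auto
    have "(2::nat) ^ M < 2 ^ Suc m" using n m(2) by linarith
    then have "M \<le> m" by (simp only: power_strict_increasing_iff less_Suc_eq_le one_less_numeral_iff semiring_norm)
    then show "norm (f n - 0) < \<delta>" using le[OF m] M[of m] by simp
  qed
qed

text \<open>Between \<open>2 ^ m\<close> and \<open>2 ^ Suc m\<close> the numerator is at most its
  value at the right end and the norming at least its value at the left end; returning to a common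
  index costs the factor K.\<close>

lemma tendsto_0_of_dyadic_mono:
  fixes P b :: "nat \<Rightarrow> real"
  assumes P: "\<And>n. 0 \<le> P n" "\<And>m n. m \<le> n \<Longrightarrow> P m \<le> P n"
    and b: "\<And>n. 1 \<le> n \<Longrightarrow> 0 < b n" "\<And>m n. 1 \<le> m \<Longrightarrow> m \<le> n \<Longrightarrow> b m \<le> b n"
      "\<And>n. 1 \<le> n \<Longrightarrow> b (2 * n) \<le> K * b n"
    and lim: "(\<lambda>j. P (2 ^ j) / b (2 ^ j)) \<longlonglongrightarrow> 0"
  shows "(\<lambda>n. P n / b n) \<longlonglongrightarrow> 0"
proof (rule tendsto_0_of_dyadic_bound)
  show "(\<lambda>m. K * (P (2 ^ Suc m) / b (2 ^ Suc m))) \<longlonglongrightarrow> 0"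
    using tendsto_mult_right_zero[OF LIMSEQ_Suc[OF lim], of K] by simp
  fix m n :: nat assume mn: "2 ^ m \<le> n" "n < 2 ^ Suc m"
  have "1 \<le> n" using mn(1) order_trans[OF one_le_power[of "2::nat" m]] by simp
  have "\<bar>P n / b n\<bar> = P n / b n" using P(1)[of n] b(1)[OF \<open>1 \<le> n\<close>] by simp
  also have "\<dots> \<le> P (2 ^ Suc m) / b (2 ^ m)"
    using P mn b(1)[of "2 ^ m"] b(2)[of "2 ^ m" n] by (intro frac_le) auto
  also have "\<dots> \<le> P (2 ^ Suc m) / (b (2 ^ Suc m) / K)"
  proof (intro divide_left_mono)
    have "0 < b (2 ^ Suc m)" "b (2 ^ Suc m) \<le> K * b (2 ^ m)" "0 < b (2 ^ m)"
      using b(1)[of "2 ^ Suc m"] b(3)[of "2 ^ m"] b(1)[of "2 ^ m"] by auto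
    moreover from this have "0 < K" by (metis less_le_trans zero_less_mult_pos2)
    ultimately show "b (2 ^ Suc m) / K \<le> b (2 ^ m)" "0 < b (2 ^ m) * (b (2 ^ Suc m) / K)"
      by (auto simp: field_simps)
  qed (rule P)
  finally show "\<bar>P n / b n\<bar> \<le> K * (P (2 ^ Suc m) / b (2 ^ Suc m))" by (simp add: mult_ac)
qed

lemma weighted_cesaro:
  fixes a \<mu> :: "nat \<Rightarrow> real"
  assumes a0: "\<And>k. 0 \<le> a k" and a: "\<And>n. (\<Sum>k=1..n. a k) \<le> C * real n"
    and \<mu>: "\<mu> \<longlonglongrightarrow> 0"
  shows "(\<lambda>n. (\<Sum>k=1..n. a k * \<mu> k) / real n) \<longlonglongrightarrow> 0"
proof (rule LIMSEQ_I)
  fix \<delta> :: real assume \<delta>: "0 < \<delta>"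
  have C: "0 \<le> C" using a[of 1] a0[of 1] by simp
  \<comment> \<open>The summand 1 keeps the denominator positive when C = 0; the tail then
    contributes at most half of \<open>\<delta>\<close>.\<close>
  define \<eta> where "\<eta> = \<delta> / (2 * (C + 1))"
  have \<eta>: "0 < \<eta>" "\<eta> * C \<le> \<delta> / 2" using \<delta> C by (auto simp: \<eta>_def field_simps)
  obtain K where K: "\<And>k. K \<le> k \<Longrightarrow> \<bar>\<mu> k\<bar> < \<eta>" using LIMSEQ_D[OF \<mu> \<eta>(1)] by auto
  define A where "A = (\<Sum>k=1..K. a k * \<bar>\<mu> k\<bar>)"
  have "\<forall>\<^sub>F n in sequentially. A / real n < \<delta> / 2"
    using \<delta> by (intro order_tendstoD[OF lim_const_over_n]) simp
  then obtain n0 where n0: "\<And>n. n0 \<le> n \<Longrightarrow> A / real n < \<delta> / 2"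
    unfolding eventually_sequentially by auto
  show "\<exists>no. \<forall>n\<ge>no. norm ((\<Sum>k=1..n. a k * \<mu> k) / real n - 0) < \<delta>"
  proof (intro exI[of _ "max (Suc n0) K"] allI impI)
    fix n assume n: "max (Suc n0) K \<le> n"
    have "\<bar>\<Sum>k=1..n. a k * \<mu> k\<bar> \<le> (\<Sum>k=1..n. a k * \<bar>\<mu> k\<bar>)"
      by (rule order_trans[OF sum_abs]) (simp add: abs_mult a0)
    also have "\<dots> \<le> (\<Sum>k=1..n. (if k \<in> {1..K} then a k * \<bar>\<mu> k\<bar> else 0) + \<eta> * a k)"
    proof (intro sum_mono)
      fix k assume "k \<in> {1..n}"
      then show "a k * \<bar>\<mu> k\<bar> \<le> (if k \<in> {1..K} then a k * \<bar>\<mu> k\<bar> else 0) + \<eta> * a k"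
        using K[of k] mult_left_mono[of "\<bar>\<mu> k\<bar>" \<eta> "a k"] a0[of k] \<eta>(1) by (auto simp: mult.commute)
    qed
    also have "\<dots> = A + \<eta> * (\<Sum>k=1..n. a k)"
    proof -
      have "{1..n} \<inter> {1..K} = {1..K}" using n by auto
      then have "(\<Sum>k=1..n. if k \<in> {1..K} then a k * \<bar>\<mu> k\<bar> else 0) = A"
        unfolding A_def by (simp only: sum.inter_restrict[symmetric] finite_atLeastAtMost)
      then show ?thesis by (simp only: sum.distrib sum_distrib_left)
    qed
    also have "\<dots> \<le> A + \<eta> * (C * real n)" using \<eta> by (intro add_left_mono mult_left_mono a) auto
    also have "\<dots> \<le> A + \<delta> / 2 * real n"
      using mult_right_mono[OF \<eta>(2), of "real n"] by (simp add: mult_ac)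
    finally have "\<bar>\<Sum>k=1..n. a k * \<mu> k\<bar> / real n \<le> A / real n + \<delta> / 2"
      using n by (simp add: field_simps)
    moreover have "A / real n < \<delta> / 2" using n by (intro n0) simp
    ultimately show "norm ((\<Sum>k=1..n. a k * \<mu> k) / real n - 0) < \<delta>"
      unfolding real_norm_def diff_0_right abs_divide abs_of_nat by linarith
  qed
qed

lemma eventually_zero_sum_over_tendsto_0:
  fixes f b :: "nat \<Rightarrow> real"
  assumes "\<forall>\<^sub>F k in sequentially. f k = 0" and b: "filterlim b at_top sequentially"
  shows "(\<lambda>n. (\<Sum>k=1..n. f k) / b n) \<longlonglongrightarrow> 0"
proof -
  obtain K where K: "\<And>k. K \<le> k \<Longrightarrow> f k = 0"
    using assms(1) unfolding eventually_sequentially by auto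
  have "(\<lambda>n. (\<Sum>k=1..K. f k) / b n) \<longlonglongrightarrow> 0"
    by (intro real_tendsto_divide_at_top[OF tendsto_const b])
  moreover have "\<forall>\<^sub>F n in sequentially. (\<Sum>k=1..K. f k) / b n = (\<Sum>k=1..n. f k) / b n"
    using eventually_ge_at_top[of K]
  proof eventually_elim
    case (elim n)
    then have "(\<Sum>k=1..K. f k) = (\<Sum>k=1..n. f k)"
      by (intro sum.mono_neutral_left) (auto intro: K)
    then show ?case by simp
  qed
  ultimately show ?thesis by (rule Lim_transform_eventually)
qed

lemma sum_le_of_sum_squares_le:
  fixes a :: "nat \<Rightarrow> real"
  assumes "(\<Sum>k=1..n. (a k)\<^sup>2) \<le> C * real n"
  shows "(\<Sum>k=1..n. a k) \<le> (C + 1) * real n"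
proof -
  have "a k \<le> (a k)\<^sup>2 + 1" for k
    using zero_le_power2[of "a k - 1 / 2"] by (simp add: power2_eq_square algebra_simps)
  then have "(\<Sum>k=1..n. a k) \<le> (\<Sum>k=1..n. (a k)\<^sup>2 + 1)" by (intro sum_mono)
  then show ?thesis using assms by (simp add: sum.distrib algebra_simps)
qed

text \<open>Induction by halving. On the upper half k^(q-1) is at most (n/2)^(q-1), which uses q
  \<le> 1, and the lower half is the induction hypothesis.\<close>

lemma weighted_sum_powr_le:
  fixes a :: "nat \<Rightarrow> real"
  assumes a0: "\<And>k. 0 \<le> a k" and a: "\<And>n. (\<Sum>k=1..n. a k) \<le> C * real n" and q: "0 < q" "q \<le> 1"
  shows "(\<Sum>k=1..n. a k * real k powr (q - 1)) \<le> 2 * C / (1 - (1 / 2) powr q) * real n powr q"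
proof (induction n rule: less_induct)
  case (less n)
  define K where "K = 2 * C / (1 - (1 / 2) powr q)"
  have C: "0 \<le> C" using a[of 1] a0[of 1] by simp
  have h: "(1 / 2) powr q < (1::real)" using powr_less_mono2[of q "1/2" 1] q by simp
  \<comment> \<open>K is the fixed point of the halving recursion: the lower half contributes
    \<open>K * (1 / 2) powr q\<close>, the upper half at most \<open>2 * C\<close>.\<close>
  have K: "K * (1 / 2) powr q + 2 * C = K"
  proof -
    have "K * (1 - (1 / 2) powr q) = 2 * C" using h q by (simp add: K_def)
    then show ?thesis by (simp add: algebra_simps)
  qed
  have K0: "0 \<le> K" using h C by (simp add: K_def)
  show ?case
  proof (cases "n = 0")
    case False
    let ?h = "n div 2"
    have un: "{1..n} = {1..?h} \<union> {?h<..n}" by auto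
    have "(\<Sum>k=1..n. a k * real k powr (q - 1)) =
        (\<Sum>k=1..?h. a k * real k powr (q - 1)) + (\<Sum>k\<in>{?h<..n}. a k * real k powr (q - 1))"
      by (subst un) (intro sum.union_disjoint, auto)
    also have "(\<Sum>k=1..?h. a k * real k powr (q - 1)) \<le> K * real ?h powr q"
      unfolding K_def using False by (intro less) auto
    also have "\<dots> \<le> K * (real n / 2) powr q" using q K0 by (intro mult_left_mono powr_mono2) auto
    also have "(\<Sum>k\<in>{?h<..n}. a k * real k powr (q - 1)) \<le> (\<Sum>k\<in>{?h<..n}. a k * (real n / 2) powr (q - 1))"
    proof (intro sum_mono mult_left_mono a0)
      fix k assume "k \<in> {?h<..n}"
      then have "real n / 2 \<le> real k" by auto
      then show "real k powr (q - 1) \<le> (real n / 2) powr (q - 1)"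
        using q False by (intro powr_mono2') auto
    qed
    also have "\<dots> \<le> (\<Sum>k=1..n. a k) * (real n / 2) powr (q - 1)"
      unfolding sum_distrib_right[symmetric] by (intro mult_right_mono sum_mono2) (auto simp: a0)
    also have "\<dots> \<le> C * real n * (real n / 2) powr (q - 1)" by (intro mult_right_mono a) auto
    also have "\<dots> = 2 * C * (real n / 2) powr q"
      using False by (simp add: powr_diff field_simps)
    also have "\<dots> \<le> 2 * C * real n powr q" using C q by (intro mult_left_mono powr_mono2) auto
    also have "K * (real n / 2) powr q + 2 * C * real n powr q = (K * (1 / 2) powr q + 2 * C) * real n powr q"
      by (simp add: powr_divide field_simps)
    finally show ?thesis unfolding K by (simp add: K_def add_mono)
  qed simp
qed

text \<open>Etemadi's argument: between consecutive multiples \<open>i * 2 ^ j\<close>, \<open>N \<le> i < 2 * N\<close>, of a power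
  of two the compensator grows by a small multiple of \<open>n\<close>, because the weights are square-bounded
  in the mean.\<close>

lemma etemadi_gap_filling:
  fixes a z \<mu> :: "nat \<Rightarrow> real" and B C :: real
  assumes a0: "\<And>k. 0 \<le> a k" and a2: "\<And>n. (\<Sum>k=1..n. (a k)\<^sup>2) \<le> C * real n"
    and z: "\<And>k. 0 \<le> z k" and \<mu>: "\<And>k. 1 \<le> k \<Longrightarrow> 0 \<le> \<mu> k" "\<And>k. 1 \<le> k \<Longrightarrow> \<mu> k \<le> B"
  defines "D \<equiv> \<lambda>n. \<Sum>k=1..n. a k * (z k - \<mu> k)"
  assumes lim: "\<And>i. 1 \<le> i \<Longrightarrow> (\<lambda>j. D (i * 2 ^ j) / real (i * 2 ^ j)) \<longlonglongrightarrow> 0"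
  shows "(\<lambda>n. D n / real n) \<longlonglongrightarrow> 0"
proof (rule LIMSEQ_I)
  fix \<delta> :: real assume \<delta>: "0 < \<delta>"
  have C: "0 \<le> C" using order_trans[OF zero_le_power2 a2[of 1, simplified]] by simp
  have B: "0 \<le> B" using \<mu>[of 1] by simp
  \<comment> \<open>The weights in a gap are bounded through
    \<open>a \<le> \<theta> * a\<^sup>2 + 1 / \<theta>\<close>. A small \<open>\<theta>\<close>
    controls the quadratic part by the mean square bound; afterwards a large N controls the constant
    part, since it makes the gaps short relative to n.\<close>
  define \<theta> where "\<theta> = \<delta> / (8 * (B * C + 1))"
  have BC: "0 \<le> B * C" using B C by simp
  have \<theta>: "0 < \<theta>" "B * (2 * \<theta> * C) \<le> \<delta> / 4"
    using \<delta> BC by (auto simp: \<theta>_def field_simps)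
  obtain N0 :: nat where N0: "8 * B / (\<theta> * \<delta>) \<le> real N0" using real_arch_simple by blast
  define N where "N = Suc N0"
  have "8 * B \<le> \<theta> * \<delta> * real N0" using N0 \<theta> \<delta> by (simp add: field_simps)
  also have "\<dots> \<le> \<theta> * \<delta> * real N" using \<theta> \<delta> by (intro mult_left_mono) (auto simp: N_def)
  finally have N: "1 \<le> N" "B / (\<theta> * real N) \<le> \<delta> / 8"
    using \<theta> by (auto simp: N_def pos_divide_le_eq mult_ac)
  \<comment> \<open>Finitely many i suffice, so one J serves them all. The value
    \<open>2 * N\<close> is included because it can be the right neighbour of some i < 2 N.\<close>
  have "\<forall>\<^sub>F j in sequentially. \<forall>i\<in>{N..2 * N}. \<bar>D (i * 2 ^ j) / real (i * 2 ^ j)\<bar> < \<delta> / 4"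
  proof (intro eventually_ball_finite ballI)
    fix i assume "i \<in> {N..2 * N}"
    then show "\<forall>\<^sub>F j in sequentially. \<bar>D (i * 2 ^ j) / real (i * 2 ^ j)\<bar> < \<delta> / 4"
      using order_tendstoD(2)[OF tendsto_rabs_zero[OF lim[of i]], of "\<delta> / 4"] N \<delta> by simp
  qed simp
  then obtain J where J0: "\<forall>j\<ge>J. \<forall>i\<in>{N..2 * N}. \<bar>D (i * 2 ^ j) / real (i * 2 ^ j)\<bar> < \<delta> / 4"
    unfolding eventually_sequentially by blast
  have J: "\<bar>D (i * 2 ^ j) / real (i * 2 ^ j)\<bar> < \<delta> / 4" if "J \<le> j" "N \<le> i" "i \<le> 2 * N" for i j
    using J0[rule_format, of j i] that by simp
  have D_diff: "D n' - D n = (\<Sum>k\<in>{n<..n'}. a k * (z k - \<mu> k))" if "n \<le> n'" for n n'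
  proof -
    have "{1..n'} = {1..n} \<union> {n<..n'}" using that by auto
    moreover have "{1..n} \<inter> {n<..n'} = {}" by auto
    ultimately show ?thesis
      unfolding D_def by (simp only: sum.union_disjoint finite_atLeastAtMost finite_greaterThanAtMost)
  qed
  \<comment> \<open>As z is nonnegative, D can decrease only through the compensator, by at most B
    times the weights passed.\<close>
  have D_lower: "D n' - D n \<ge> - B * (\<Sum>k\<in>I. a k)" if "n \<le> n'" "{n<..n'} \<subseteq> I" "finite I" for n n' I
  proof -
    have "(\<Sum>k\<in>{n<..n'}. - B * a k) \<le> D n' - D n"
      unfolding D_diff[OF that(1)]
    proof (intro sum_mono)
      fix k assume "k \<in> {n<..n'}"
      then show "- B * a k \<le> a k * (z k - \<mu> k)"
        using mult_left_mono[of "- B" "z k - \<mu> k" "a k"] a0[of k] z[of k] \<mu>(2)[of k]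
        by (simp add: mult.commute)
    qed
    moreover have "B * (\<Sum>k\<in>{n<..n'}. a k) \<le> B * (\<Sum>k\<in>I. a k)"
      using that B by (intro mult_left_mono sum_mono2 a0)
    ultimately show ?thesis by (simp add: sum_distrib_left[symmetric] sum_negf)
  qed
  show "\<exists>no. \<forall>n\<ge>no. norm (D n / real n - 0) < \<delta>"
  proof (intro exI[of _ "N * 2 ^ J"] allI impI)
    fix n assume n: "N * 2 ^ J \<le> n"
    have "2 ^ J \<le> n div N" using n N by (simp add: less_eq_div_iff_mult_less_eq mult.commute)
    then have "1 \<le> n div N" using order_trans[OF one_le_power[of "2::nat" J]] by simp
    then obtain j where j: "2 ^ j \<le> n div N" "n div N < 2 ^ Suc j"
      using ex_power_ivl1[of 2 "n div N"] by auto
    have "(2::nat) ^ J < 2 ^ Suc j" using \<open>2 ^ J \<le> n div N\<close> j(2) by linarith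
    then have "J \<le> j"
      by (simp only: power_strict_increasing_iff less_Suc_eq_le one_less_numeral_iff semiring_norm)
    have jn: "N * 2 ^ j \<le> n" "n < 2 * N * 2 ^ j"
      using j N by (auto simp: less_eq_div_iff_mult_less_eq div_less_iff_less_mult mult_ac)
    \<comment> \<open>This quotient lies in [N, 2 N), so the grid gap around n has length
      \<open>2 ^ j\<close>, at most n / N.\<close>
    define i where "i = n div 2 ^ j"
    have i: "N \<le> i" "i < 2 * N"
      using jn by (auto simp: i_def less_eq_div_iff_mult_less_eq div_less_iff_less_mult)
    define n0 n1 where "n0 = i * 2 ^ j" and "n1 = Suc i * 2 ^ j"
    have "n mod 2 ^ j < 2 ^ j" by simp
    then have n01: "n0 \<le> n" "n \<le> n1" "n1 = n0 + 2 ^ j"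
      using div_mult_mod_eq[of n "2 ^ j"] unfolding n0_def n1_def i_def mult_Suc by linarith+
    have npos: "0 < n" using jn N by (metis gr0I le_zero_eq mult_is_0 not_one_le_zero power_not_zero zero_neq_numeral)
    have two_j: "real N * 2 ^ j \<le> real n" using jn(1) by (metis of_nat_le_iff of_nat_mult of_nat_numeral of_nat_power)
    have "1 * 2 ^ j \<le> N * 2 ^ j" using N(1) by (intro mult_right_mono) auto
    then have "n1 \<le> 2 * n" using jn(1) n01 by linarith
    then have n1_le: "real n1 \<le> 2 * real n" by linarith
    have "(\<Sum>k\<in>{n0<..n1}. a k) \<le> (\<Sum>k\<in>{n0<..n1}. \<theta> * (a k)\<^sup>2 + 1 / \<theta>)"
    proof (intro sum_mono)
      fix k
      have "0 \<le> (\<theta> * a k - 1)\<^sup>2 + \<theta> * a k" using \<theta> a0[of k] by simp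
      then have "\<theta> * a k \<le> \<theta> * (\<theta> * (a k)\<^sup>2 + 1 / \<theta>)"
        using \<theta> by (simp add: power2_eq_square algebra_simps)
      then show "a k \<le> \<theta> * (a k)\<^sup>2 + 1 / \<theta>" using \<theta> by (simp only: mult_le_cancel_left_pos)
    qed
    also have "\<dots> = \<theta> * (\<Sum>k\<in>{n0<..n1}. (a k)\<^sup>2) + 2 ^ j / \<theta>"
      using n01 by (simp add: sum.distrib sum_distrib_left)
    also have "\<dots> \<le> \<theta> * (C * real n1) + 2 ^ j / \<theta>"
    proof -
      have "(\<Sum>k\<in>{n0<..n1}. (a k)\<^sup>2) \<le> (\<Sum>k=1..n1. (a k)\<^sup>2)" by (intro sum_mono2) auto
      then show ?thesis using a2[of n1] \<theta> by (intro add_right_mono mult_left_mono) auto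
    qed
    also have "\<dots> \<le> \<theta> * (C * (2 * real n)) + (real n / real N) / \<theta>"
      using \<theta> C n1_le two_j N
      by (intro add_mono mult_left_mono divide_right_mono) (auto simp: field_simps)
    finally have "B * (\<Sum>k\<in>{n0<..n1}. a k) \<le> B * (\<theta> * (C * (2 * real n)) + (real n / real N) / \<theta>)"
      using B by (intro mult_left_mono)
    also have "\<dots> = (B * (2 * \<theta> * C)) * real n + B / (\<theta> * real N) * real n"
      by (simp add: algebra_simps)
    also have "\<dots> \<le> \<delta> / 4 * real n + \<delta> / 8 * real n"
      using \<theta> N by (intro add_mono mult_right_mono) auto
    finally have gap: "B * (\<Sum>k\<in>{n0<..n1}. a k) \<le> 3 / 8 * \<delta> * real n" by simp
    have D_grid: "\<bar>D (i' * 2 ^ j)\<bar> \<le> \<delta> / 4 * (2 * real n)" if "i' = i \<or> i' = Suc i" for i'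
    proof -
      have "i' * 2 ^ j \<le> n1" using that by (auto simp: n1_def)
      then have le: "real (i' * 2 ^ j) \<le> 2 * real n" using n1_le by linarith
      have "\<bar>D (i' * 2 ^ j) / real (i' * 2 ^ j)\<bar> < \<delta> / 4" using that i \<open>J \<le> j\<close> by (intro J) auto
      moreover have "0 < real (i' * 2 ^ j)" using that i N by auto
      ultimately have "\<bar>D (i' * 2 ^ j)\<bar> \<le> \<delta> / 4 * real (i' * 2 ^ j)"
        by (simp only: abs_divide abs_of_pos pos_divide_less_eq less_imp_le)
      also have "\<dots> \<le> \<delta> / 4 * (2 * real n)" using le \<delta> by (intro mult_left_mono) auto
      finally show ?thesis .
    qed
    have sub: "{n<..n1} \<subseteq> {n0<..n1}" "{n0<..n} \<subseteq> {n0<..n1}" using n01 by auto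
    have "- B * (\<Sum>k\<in>{n0<..n1}. a k) \<le> D n1 - D n" "- B * (\<Sum>k\<in>{n0<..n1}. a k) \<le> D n - D n0"
      using D_lower[OF n01(2) sub(1)] D_lower[OF n01(1) sub(2)] by (simp_all only: finite_greaterThanAtMost)
    then have "D n \<le> D n1 + 3 / 8 * \<delta> * real n" "D n0 - 3 / 8 * \<delta> * real n \<le> D n"
      using gap by linarith+
    \<comment> \<open>The one-sided bound serves twice: forward to n1 it bounds \<open>D n\<close>
      from above, back to n0 from below. The grid values contribute 1/2 and the gap 3/8.\<close>
    then have "\<bar>D n\<bar> \<le> 7 / 8 * \<delta> * real n"
      using D_grid[of i] D_grid[of "Suc i"] unfolding n0_def n1_def abs_le_iff by linarith
    also have "\<dots> < \<delta> * real n" using \<delta> npos by simp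
    finally show "norm (D n / real n - 0) < \<delta>" using npos by (simp add: field_simps)
  qed
qed

section \<open>Integrable errors\<close>

text \<open>A window of length s on which both factors have lower bounds already accounts for this
  much of the integral. It converts an integral condition into a bound on G at the single level
  s.\<close>

lemma nn_integral_ge_window:
  fixes F G :: "real \<Rightarrow> real"
  assumes "0 < s" "{s..2 * s} \<subseteq> T" "0 \<le> m"
    and F: "\<And>t. s \<le> t \<Longrightarrow> t \<le> 2 * s \<Longrightarrow> m \<le> F t"
    and G: "\<And>t. s \<le> t \<Longrightarrow> g \<le> G t" and "0 \<le> g"
  shows "ennreal (s * m * g) \<le> (\<integral>\<^sup>+t\<in>T. ennreal (F t * G t) \<partial>lborel)"
proof -
  have "ennreal (s * m * g) = (\<integral>\<^sup>+t\<in>{s..2 * s}. ennreal (m * g) \<partial>lborel)"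
    using assms by (simp add: nn_integral_cmult_indicator ennreal_mult[symmetric] mult_ac)
  also have "\<dots> \<le> (\<integral>\<^sup>+t\<in>T. ennreal (F t * G t) \<partial>lborel)"
  proof (intro nn_integral_mono)
    fix t
    show "ennreal (m * g) * indicator {s..2 * s} t \<le> ennreal (F t * G t) * indicator T t"
    proof (cases "t \<in> {s..2 * s}")
      case True
      then have "m * g \<le> F t * G t"
        using assms(3,6) F[of t] G[of t] order_trans[OF assms(3) F[of t]] by (intro mult_mono) auto
      then show ?thesis using True assms(2) by (auto simp: ennreal_leI)
    qed simp
  qed
  finally show ?thesis .
qed

lemma tendsto_0_of_square:
  fixes f :: "nat \<Rightarrow> real"
  assumes "(\<lambda>n. (f n)\<^sup>2) \<longlonglongrightarrow> 0"
  shows "f \<longlonglongrightarrow> 0"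
  using tendsto_real_sqrt[OF assms] by (simp add: tendsto_rabs_zero_iff)

text \<open>A smooth substitute for \<open>Log\<close>, chosen so that \<open>n powr (1 / r) / damp n\<close> is nondecreasing
  from \<open>n = 1\<close> on.\<close>

definition damp :: "nat \<Rightarrow> real" where
  "damp n = 2 + ln (real n)"

lemma damp_ge_2: "1 \<le> n \<Longrightarrow> 2 \<le> damp n"
  by (simp add: damp_def)

lemma damp_mono: "1 \<le> m \<Longrightarrow> m \<le> n \<Longrightarrow> damp m \<le> damp n"
  by (simp add: damp_def)

lemma ln_2_le_1: "ln 2 \<le> (1::real)"
  using ln_le_minus_one[of "2::real"] by simp

lemma damp_double:
  assumes "1 \<le> n"
  shows "damp (2 * n) \<le> 2 * damp n"
proof -
  define c t where "c = ln (2::real)" and "t = ln (real n)"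
  have "0 \<le> t" "c \<le> 1" "damp n = 2 + t" "damp (2 * n) = 2 + (c + t)"
    using assms ln_2_le_1 by (simp_all add: c_def t_def damp_def ln_mult)
  then show ?thesis by simp
qed

context pqd_sequence
begin

section \<open>From integral conditions to discrete covariance conditions, and truncation\<close>

lemma G_cov_mono:
  assumes "1 \<le> k" "1 \<le> l" "0 \<le> s" "s \<le> t"
  shows "G_cov M (eps k) (eps l) s \<le> G_cov M (eps k) (eps l) t"
  using assms by (simp add: G_cov_eq_cov cov_clip_mono pqd_eps)

lemma G_cov_nonneg:
  "1 \<le> k \<Longrightarrow> 1 \<le> l \<Longrightarrow> 0 \<le> s \<Longrightarrow> 0 \<le> G_cov M (eps k) (eps l) s"
  by (simp add: G_cov_eq_cov cov_clip_nonneg pqd_eps)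

text \<open>Each integral is bounded below on the window [s l, 2 s l], where monotonicity replaces
  \<open>G_cov\<close> by its value at s l. The 8 is 2^3, the loss of a kernel of order t^(-3) at
  the far end. Domination of the products \<open>a k * a l\<close> is enough, so both the positive
  and the negative part of a design column qualify.\<close>

lemma summable_G_cov_of_integral:
  fixes a s w :: "nat \<Rightarrow> real" and x :: "nat \<Rightarrow> nat \<Rightarrow> real" and F :: "real \<Rightarrow> real"
  assumes a0: "\<And>k. 0 \<le> a k" and ax: "\<And>k l. a k * a l \<le> x k l"
    and fin: "(\<Sum>l. \<Sum>k\<in>{1..<l}. ennreal (x k l) *
      (\<integral>\<^sup>+t\<in>T l. ennreal (F t * G_cov M (eps k) (eps l) t) \<partial>lborel)) < \<infinity>"
    and w0: "\<And>l. 0 \<le> w l"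
    and s: "\<forall>\<^sub>F l in sequentially. 0 < s l \<and> {s l..2 * s l} \<subseteq> T l \<and>
      (\<forall>t. s l \<le> t \<longrightarrow> t \<le> 2 * s l \<longrightarrow> w l / (8 * s l) \<le> F t)"
  shows "summable (\<lambda>l. w l * (\<Sum>k\<in>{1..<l}. a k * a l * G_cov M (eps k) (eps l) (s l)))"
proof -
  let ?f = "\<lambda>l. w l * (\<Sum>k\<in>{1..<l}. a k * a l * G_cov M (eps k) (eps l) (s l))"
  let ?h = "\<lambda>l. \<Sum>k\<in>{1..<l}. ennreal (x k l) *
      (\<integral>\<^sup>+t\<in>T l. ennreal (F t * G_cov M (eps k) (eps l) t) \<partial>lborel)"
  obtain l0 where l0: "\<And>l. l0 \<le> l \<Longrightarrow> 0 < s l" "\<And>l. l0 \<le> l \<Longrightarrow> {s l..2 * s l} \<subseteq> T l"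
    "\<And>l t. l0 \<le> l \<Longrightarrow> s l \<le> t \<Longrightarrow> t \<le> 2 * s l \<Longrightarrow> w l / (8 * s l) \<le> F t"
    using s unfolding eventually_sequentially by blast
  have f0: "0 \<le> ?f l" if "l0 \<le> l" for l
    using w0 a0 l0(1)[OF that]
    by (intro mult_nonneg_nonneg sum_nonneg) (auto intro!: mult_nonneg_nonneg G_cov_nonneg)
  have le: "ennreal (?f l / 8) \<le> ?h l" if l: "l0 \<le> l" for l
  proof -
    let ?g = "\<lambda>k. G_cov M (eps k) (eps l) (s l)"
    have g0: "0 \<le> ?g k" if "k \<in> {1..<l}" for k
      using that l0(1)[OF l] by (intro G_cov_nonneg) auto
    have "ennreal (w l / 8 * (a k * a l * ?g k)) \<le> ennreal (x k l) *
      (\<integral>\<^sup>+t\<in>T l. ennreal (F t * G_cov M (eps k) (eps l) t) \<partial>lborel)" if k: "k \<in> {1..<l}" for k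
    proof -
      have "ennreal (s l * (w l / (8 * s l)) * ?g k) \<le>
          (\<integral>\<^sup>+t\<in>T l. ennreal (F t * G_cov M (eps k) (eps l) t) \<partial>lborel)"
        using l0[OF l] w0[of l] k g0[OF k]
        by (intro nn_integral_ge_window) (auto intro!: G_cov_mono)
      then have "ennreal (w l / 8 * ?g k) \<le>
          (\<integral>\<^sup>+t\<in>T l. ennreal (F t * G_cov M (eps k) (eps l) t) \<partial>lborel)"
        using l0(1)[OF l] by simp
      moreover have "ennreal (w l / 8 * (a k * a l * ?g k)) = ennreal (a k * a l) * ennreal (w l / 8 * ?g k)"
        using a0[of k] a0[of l] w0[of l] g0[OF k] by (simp add: ennreal_mult[symmetric] mult_ac)
      ultimately show ?thesis using ax[of k l] by (simp only: mult_mono ennreal_leI zero_le)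
    qed
    then have "(\<Sum>k\<in>{1..<l}. ennreal (w l / 8 * (a k * a l * ?g k))) \<le> ?h l" by (rule sum_mono)
    moreover have "(\<Sum>k\<in>{1..<l}. ennreal (w l / 8 * (a k * a l * ?g k))) = ennreal (?f l / 8)"
      using a0 w0 g0 by (subst sum_ennreal) (auto simp: sum_distrib_left sum_divide_distrib)
    ultimately show ?thesis by simp
  qed
  \<comment> \<open>Below l0 no window estimate is available; setting those terms to 0 does not
    affect summability.\<close>
  let ?f' = "\<lambda>l. if l0 \<le> l then ?f l / 8 else 0"
  have "(\<Sum>l. ennreal (?f' l)) \<le> (\<Sum>l. ?h l)"
    using le by (intro suminf_le) auto
  also note fin
  finally have "summable ?f'"
    using f0 by (intro summable_suminf_not_top) (auto simp: less_top)
  then have "summable (\<lambda>l. ?f' l * 8)" by (rule summable_mult2)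
  moreover have "\<forall>\<^sub>F l in sequentially. ?f' l * 8 = ?f l"
    using eventually_ge_at_top[of l0] by eventually_elim simp
  ultimately show ?thesis by (simp only: summable_cong)
qed

lemma powr_half:
  assumes "1 \<le> n"
  shows "real (2 * n) powr (- 2 / r) \<le> real n powr (- 2 / r) / 2"
proof -
  define e where "e = - 2 / r"
  have "2 powr e \<le> 2 powr (-1 :: real)"
    using r_range by (intro powr_mono) (auto simp: e_def field_simps)
  then have "2 powr e \<le> 1 / 2" by (simp add: powr_minus_divide)
  then have "2 powr e * real n powr e \<le> 1 / 2 * real n powr e" by (rule mult_right_mono) simp
  then show ?thesis by (simp add: powr_mult e_def)
qed

lemma powr_anti: "1 \<le> m \<Longrightarrow> m \<le> n \<Longrightarrow> real n powr (- 2 / r) \<le> real m powr (- 2 / r)"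
  using r_range by (intro powr_mono2') auto

text \<open>Almost surely only finitely many errors differ from their clips, so the numerator is
  eventually constant.\<close>

lemma AE_slln_truncation:
  assumes "filterlim b at_top sequentially"
  shows "AE \<omega> in M. (\<lambda>n. (\<Sum>k=1..n. a k * (eps k \<omega> -
    clip (- (real k powr (1 / r))) (real k powr (1 / r)) (eps k \<omega>))) / b n) \<longlonglongrightarrow> 0"
  using AE_eventually_abs_eps_le
proof eventually_elim
  case (elim \<omega>)
  show ?case
    by (rule eventually_zero_sum_over_tendsto_0[OF _ assms])
      (use elim in \<open>eventually_elim; auto simp: clip_def\<close>)
qed

lemma expectation_clip_tendsto:
  assumes "integrable M (eps 1)"
  shows "(\<lambda>k. expectation (\<lambda>\<omega>. clip (- real k) (real k) (eps 1 \<omega>))) \<longlonglongrightarrow> expectation (eps 1)"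
proof (rule integral_dominated_convergence[where w = "\<lambda>\<omega>. \<bar>eps 1 \<omega>\<bar>"])
  show "AE \<omega> in M. (\<lambda>k. clip (- real k) (real k) (eps 1 \<omega>)) \<longlonglongrightarrow> eps 1 \<omega>"
  proof (intro AE_I2 tendsto_eventually)
    fix \<omega>
    obtain K :: nat where K: "\<bar>eps 1 \<omega>\<bar> \<le> real K" using real_arch_simple by blast
    show "\<forall>\<^sub>F k in sequentially. clip (- real k) (real k) (eps 1 \<omega>) = eps 1 \<omega>"
      using eventually_ge_at_top[of K]
    proof eventually_elim
      case (elim k)
      then have "\<bar>eps 1 \<omega>\<bar> \<le> real k" using K by linarith
      then show ?case by (auto simp: clip_def)
    qed
  qed
  show "AE \<omega> in M. norm (clip (- real k) (real k) (eps 1 \<omega>)) \<le> \<bar>eps 1 \<omega>\<bar>" for k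
    by (intro AE_I2) (auto simp: clip_def)
qed (use assms in auto)

context
  fixes a :: "nat \<Rightarrow> real" and C :: real
  assumes a0: "\<And>k. 0 \<le> a k" and a2: "\<And>n. (\<Sum>k=1..n. (a k)\<^sup>2) \<le> C * real n"
begin

text \<open>Centring the positive and negative parts separately gives sums of nonnegative variables
  with means in [0, B], to which gap filling applies. These means need not be small; only their
  signed combination, the mean of a symmetric clip, tends to 0.\<close>

lemma slln_first_moment:
  assumes r: "r = 1" and mean0: "expectation (eps 1) = 0"
    and G: "summable (\<lambda>l. real l powr (- 2 / r) * (\<Sum>k\<in>{1..<l}. a k * a l * G_cov M (eps k) (eps l) (real l)))"
  shows "AE \<omega> in M. (\<lambda>n. (\<Sum>k=1..n. a k * eps k \<omega>) / real n) \<longlonglongrightarrow> 0"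
proof -
  have int: "integrable M (\<lambda>\<omega>. \<bar>eps 1 \<omega>\<bar>)" using moment r by simp
  then have int1: "integrable M (eps 1)" by (simp add: integrable_abs_iff)
  define B where "B = expectation (\<lambda>\<omega>. \<bar>eps 1 \<omega>\<bar>)"
  have dyadic: "AE \<omega> in M. \<forall>i\<in>{1..}. (\<lambda>j. clip_sum a u v (i * 2 ^ j) \<omega> / real (i * 2 ^ j)) \<longlonglongrightarrow> 0"
    if uv: "\<And>n. 1 \<le> n \<Longrightarrow> - real n \<le> u n \<and> u n \<le> v n \<and> v n \<le> real n" for u v
  proof (subst AE_ball_countable, simp, intro ballI)
    fix i :: nat assume i: "i \<in> {1..}"
    have "AE \<omega> in M. (\<lambda>j. real (i * 2 ^ j) powr (- 2 / r) * (clip_sum a u v (i * 2 ^ j) \<omega>)\<^sup>2) \<longlonglongrightarrow> 0"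
      by (rule AE_dyadic_tendsto_0[OF a0 a2 _ _ powr_anti powr_half _ _ _ uv G]) (use i r in auto)
    then show "AE \<omega> in M. (\<lambda>j. clip_sum a u v (i * 2 ^ j) \<omega> / real (i * 2 ^ j)) \<longlonglongrightarrow> 0"
    proof eventually_elim
      case (elim \<omega>)
      have eq: "real n powr (- 2 / r) * y\<^sup>2 = (y / real n)\<^sup>2" if "1 \<le> n" for n y
        using that unfolding r by (simp add: powr_minus_divide power_divide)
      have "(\<lambda>j. real (i * 2 ^ j) powr (- 2 / r) * (clip_sum a u v (i * 2 ^ j) \<omega>)\<^sup>2) =
          (\<lambda>j. (clip_sum a u v (i * 2 ^ j) \<omega> / real (i * 2 ^ j))\<^sup>2)"
        by (intro ext eq) (use i in simp)
      then have "(\<lambda>j. (clip_sum a u v (i * 2 ^ j) \<omega> / real (i * 2 ^ j))\<^sup>2) \<longlonglongrightarrow> 0"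
        using elim by (simp only:)
      then show ?case by (rule tendsto_0_of_square)
    qed
  qed
  have mean_pos: "0 \<le> expectation (clipped (\<lambda>_. 0) real k)"
    "expectation (clipped (\<lambda>_. 0) real k) \<le> B"
    and mean_neg: "0 \<le> - expectation (clipped (\<lambda>k. - real k) (\<lambda>_. 0) k)"
    "- expectation (clipped (\<lambda>k. - real k) (\<lambda>_. 0) k) \<le> B" if k: "1 \<le> k" for k
  proof -
    have p: "expectation (clipped (\<lambda>_. 0) real k) = expectation (\<lambda>\<omega>. clip 0 (real k) (eps 1 \<omega>))"
      unfolding clipped_def[abs_def] by (rule expectation_eps[OF k clip_measurable])
    have n: "expectation (clipped (\<lambda>k. - real k) (\<lambda>_. 0) k) = expectation (\<lambda>\<omega>. clip (- real k) 0 (eps 1 \<omega>))"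
      unfolding clipped_def[abs_def] by (rule expectation_eps[OF k clip_measurable])
    show "0 \<le> expectation (clipped (\<lambda>_. 0) real k)"
      unfolding p by (intro integral_nonneg_AE) (auto simp: clip_def)
    show "expectation (clipped (\<lambda>_. 0) real k) \<le> B"
      unfolding p B_def by (intro integral_mono integrable_clip int) (auto simp: clip_def)
    have "- expectation (clipped (\<lambda>k. - real k) (\<lambda>_. 0) k) = expectation (\<lambda>\<omega>. - clip (- real k) 0 (eps 1 \<omega>))"
      unfolding n by simp
    moreover have "0 \<le> expectation (\<lambda>\<omega>. - clip (- real k) 0 (eps 1 \<omega>))"
      by (intro integral_nonneg_AE) (auto simp: clip_def)
    moreover have "expectation (\<lambda>\<omega>. - clip (- real k) 0 (eps 1 \<omega>)) \<le> B"
      unfolding B_def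
      by (intro integral_mono integrable_minus integrable_clip int) (auto simp: clip_def)
    ultimately show "0 \<le> - expectation (clipped (\<lambda>k. - real k) (\<lambda>_. 0) k)"
      "- expectation (clipped (\<lambda>k. - real k) (\<lambda>_. 0) k) \<le> B" by auto
  qed
  have AE_pos: "AE \<omega> in M. (\<lambda>n. clip_sum a (\<lambda>_. 0) real n \<omega> / real n) \<longlonglongrightarrow> 0"
    using dyadic[of "\<lambda>_. 0" real, simplified]
  proof eventually_elim
    case (elim \<omega>)
    show ?case unfolding clip_sum_def
    proof (rule etemadi_gap_filling[OF a0 a2 _ mean_pos])
      show "0 \<le> clipped (\<lambda>_. 0) real k \<omega>" for k by (simp add: clipped_def clip_def)
    qed (use elim in \<open>simp_all add: clip_sum_def\<close>)
  qed
  have AE_neg: "AE \<omega> in M. (\<lambda>n. clip_sum a (\<lambda>k. - real k) (\<lambda>_. 0) n \<omega> / real n) \<longlonglongrightarrow> 0"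
    using dyadic[of "\<lambda>k. - real k" "\<lambda>_. 0", simplified]
  proof eventually_elim
    case (elim \<omega>)
    \<comment> \<open>The sign is flipped so that the summands are nonnegative, as gap filling
      requires.\<close>
    let ?z = "\<lambda>k. - clipped (\<lambda>k. - real k) (\<lambda>_. 0) k \<omega>"
    let ?\<mu> = "\<lambda>k. - expectation (clipped (\<lambda>k. - real k) (\<lambda>_. 0) k)"
    have eq: "clip_sum a (\<lambda>k. - real k) (\<lambda>_. 0) n \<omega> = - (\<Sum>k=1..n. a k * (?z k - ?\<mu> k))" for n
      unfolding clip_sum_def sum_negf[symmetric] by (intro sum.cong) (auto simp: algebra_simps)
    have "(\<lambda>n. (\<Sum>k=1..n. a k * (?z k - ?\<mu> k)) / real n) \<longlonglongrightarrow> 0"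
    proof (rule etemadi_gap_filling[OF a0 a2 _ mean_neg])
      show "0 \<le> ?z k" for k by (simp add: clipped_def clip_def)
      show "(\<lambda>j. (\<Sum>k=1..i * 2 ^ j. a k * (?z k - ?\<mu> k)) / real (i * 2 ^ j)) \<longlonglongrightarrow> 0" if "1 \<le> i" for i
        using elim[rule_format, of i] that unfolding eq by (simp add: tendsto_minus_cancel_left[symmetric])
    qed
    from tendsto_minus[OF this] show ?case unfolding eq by simp
  qed
  \<comment> \<open>The drift left after centring; it converges to the mean of \<open>eps 1\<close>,
    which is 0.\<close>
  define \<mu> where "\<mu> k = expectation (\<lambda>\<omega>. clip (- real k) (real k) (eps 1 \<omega>))" for k
  have \<mu>: "\<mu> \<longlonglongrightarrow> 0" using expectation_clip_tendsto[OF int1] mean0 by (simp add: \<mu>_def[abs_def])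
  have mean_lim: "(\<lambda>n. (\<Sum>k=1..n. a k * \<mu> k) / real n) \<longlonglongrightarrow> 0"
    by (rule weighted_cesaro[OF a0 sum_le_of_sum_squares_le[OF a2] \<mu>])
  have mean_eq: "expectation (clipped (\<lambda>_. 0) real k) + expectation (clipped (\<lambda>k. - real k) (\<lambda>_. 0) k) = \<mu> k"
    if "1 \<le> k" for k
  proof -
    have "\<mu> k = expectation (\<lambda>\<omega>. clip (- real k) (real k) (eps k \<omega>))"
      unfolding \<mu>_def by (rule expectation_eps[OF that clip_measurable, symmetric])
    also have "\<dots> = expectation (\<lambda>\<omega>. clip (- real k) 0 (eps k \<omega>) + clip 0 (real k) (eps k \<omega>))"
      by (subst clip_add[of "- real k" 0 "real k"]) auto
    finally show ?thesis by (simp add: clipped_def[abs_def])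
  qed
  show ?thesis
    using AE_slln_truncation[OF filterlim_real_sequentially, of a] AE_pos AE_neg
  proof eventually_elim
    case (elim \<omega>)
    have eq: "(\<Sum>k=1..n. a k * eps k \<omega>) = (\<Sum>k=1..n. a k * (eps k \<omega> -
        clip (- (real k powr (1 / r))) (real k powr (1 / r)) (eps k \<omega>)))
      + clip_sum a (\<lambda>_. 0) real n \<omega> + clip_sum a (\<lambda>k. - real k) (\<lambda>_. 0) n \<omega> + (\<Sum>k=1..n. a k * \<mu> k)" for n
      unfolding clip_sum_def sum.distrib[symmetric]
    proof (intro sum.cong refl)
      fix k assume "k \<in> {1..n}"
      then have k: "1 \<le> k" by simp
      have "clip (- real k) (real k) (eps k \<omega>) = clip (- real k) 0 (eps k \<omega>) + clip 0 (real k) (eps k \<omega>)"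
        using clip_add[of "- real k" 0 "real k"] by simp
      then show "a k * eps k \<omega> = a k * (eps k \<omega> - clip (- (real k powr (1 / r))) (real k powr (1 / r)) (eps k \<omega>))
        + a k * (clipped (\<lambda>_. 0) real k \<omega> - expectation (clipped (\<lambda>_. 0) real k))
        + a k * (clipped (\<lambda>k. - real k) (\<lambda>_. 0) k \<omega> - expectation (clipped (\<lambda>k. - real k) (\<lambda>_. 0) k))
        + a k * \<mu> k"
        unfolding mean_eq[OF k, symmetric] r by (simp add: clipped_def algebra_simps)
    qed
    have "(\<lambda>n. (\<Sum>k=1..n. a k * eps k \<omega>) / real n) = (\<lambda>n. (\<Sum>k=1..n. a k * (eps k \<omega> -
        clip (- (real k powr (1 / r))) (real k powr (1 / r)) (eps k \<omega>))) / real n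
      + clip_sum a (\<lambda>_. 0) real n \<omega> / real n + clip_sum a (\<lambda>k. - real k) (\<lambda>_. 0) n \<omega> / real n
      + (\<Sum>k=1..n. a k * \<mu> k) / real n)"
      by (simp only: eq add_divide_distrib)
    then show ?case
      using tendsto_add[OF tendsto_add[OF tendsto_add[OF elim(1,2)] elim(3)] mean_lim]
      by (simp only: add_0_right)
  qed
qed

end

end

section \<open>Errors with a finite moment of higher order\<close>

lemma half_le_ln_2: "1 / 2 \<le> ln (2::real)"
  using ln_le_minus_one[of "1 / 2 :: real"] by (simp add: ln_div)

lemma damp_at_top: "filterlim damp at_top sequentially"
  unfolding damp_def[abs_def] by real_asymp

lemma damp_pos: "1 \<le> n \<Longrightarrow> 0 < damp n"
  using damp_ge_2[of n] by linarith

text \<open>With t = n / m the denominator grows by a factor of at most 1 + ln t / 2, because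
  \<open>damp m\<close> is at least 2, while the numerator grows by t^(1/r) \<ge> 1 + ln t / r. The
  constant 2 in \<open>damp\<close> is matched to r \<le> 2.\<close>

lemma powr_over_damp_mono:
  assumes "1 \<le> m" "m \<le> n" "0 < r" "r \<le> 2"
  shows "real m powr (1 / r) / damp m \<le> real n powr (1 / r) / damp n"
proof -
  define t where "t = real n / real m"
  have t: "1 \<le> t" "real n = real m * t" using assms by (simp_all add: t_def)
  have lt: "0 \<le> ln t" using t by simp
  have "damp n = damp m + ln t" unfolding damp_def t(2) using assms t by (simp add: ln_mult)
  also have "\<dots> \<le> damp m + damp m * (ln t / 2)"
    using mult_right_mono[OF damp_ge_2[OF assms(1)] lt] by simp
  also have "\<dots> = damp m * (1 + ln t / 2)" by (simp add: algebra_simps)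
  also have "\<dots> \<le> damp m * t powr (1 / r)"
  proof (rule mult_left_mono)
    have "ln t / 2 \<le> ln t / r" using lt assms by (intro divide_left_mono) auto
    then have "1 + ln t / 2 \<le> exp (ln t / r)" using exp_ge_add_one_self[of "ln t / r"] by linarith
    also have "\<dots> = t powr (1 / r)" using t by (simp add: powr_def)
    finally show "1 + ln t / 2 \<le> t powr (1 / r)" .
  qed (use damp_pos[OF assms(1)] in simp)
  finally have "real m powr (1 / r) * damp n \<le> real m powr (1 / r) * (damp m * t powr (1 / r))"
    by (intro mult_left_mono) auto
  also have "\<dots> = real n powr (1 / r) * damp m"
    unfolding t(2) using t by (simp add: powr_mult)
  finally show ?thesis
    using damp_pos[of m] damp_pos[of n] assms by (simp add: divide_simps mult.commute)
qed

text \<open>Where the excess is nonzero, |y| > t, and |y| = |y|^r |y|^(1-r) with nonpositive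
  exponent 1 - r.\<close>

lemma excess_le_powr:
  fixes y t r :: real
  assumes "0 < t" "1 \<le> r"
  shows "\<bar>y - clip (- t) t y\<bar> \<le> \<bar>y\<bar> powr r * t powr (1 - r)"
proof (cases "\<bar>y\<bar> \<le> t")
  case True
  then have "clip (- t) t y = y" by (auto simp: clip_def)
  then show ?thesis by simp
next
  case False
  have "\<bar>y - clip (- t) t y\<bar> \<le> \<bar>y\<bar>" using assms by (auto simp: clip_def)
  also have "\<dots> = \<bar>y\<bar> powr r * \<bar>y\<bar> powr (1 - r)"
    using False assms by (simp add: powr_add[symmetric])
  also have "\<dots> \<le> \<bar>y\<bar> powr r * t powr (1 - r)"
    using False assms by (intro mult_left_mono powr_mono2') auto
  finally show ?thesis .
qed

text \<open>Each outer clip, measured from its endpoint nearer to 0, is the part of the excess over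
  [-t, t] on its side, cut off at s - t.\<close>

lemma excess_parts:
  fixes s t y :: real
  assumes "0 < t" "t \<le> s"
  shows "0 \<le> clip t s y - t" "clip t s y - t \<le> \<bar>y - clip (- t) t y\<bar>"
    "0 \<le> - t - clip (- s) (- t) y" "- t - clip (- s) (- t) y \<le> \<bar>y - clip (- t) t y\<bar>"
  using assms by (auto simp: clip_def)

context pqd_sequence
begin

abbreviation outer :: "nat \<Rightarrow> real" where "outer n \<equiv> real n powr (1 / r)"
abbreviation inner :: "nat \<Rightarrow> real" where "inner n \<equiv> real n powr (1 / r) / damp n"
abbreviation norming :: "nat \<Rightarrow> real" where "norming n \<equiv> real n powr (1 / r) * damp n"

lemma inner_bounds:
  assumes "1 \<le> n"
  shows "0 < inner n" "inner n \<le> outer n"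
  using assms damp_ge_2[OF assms] by (simp_all add: divide_simps)

lemma inner_mono: "1 \<le> m \<Longrightarrow> m \<le> n \<Longrightarrow> inner m \<le> inner n"
  using r_range by (intro powr_over_damp_mono) auto

lemma outer_mono: "m \<le> n \<Longrightarrow> outer m \<le> outer n"
  using r_range by (intro powr_mono2) auto

lemma outer_double: "outer (2 * n) \<le> 2 * outer n"
proof -
  have "2 powr (1 / r) \<le> 2 powr (1 :: real)" using r_range by (intro powr_mono) auto
  then show ?thesis by (simp add: powr_mult mult_right_mono)
qed

lemma norming_pos: "1 \<le> n \<Longrightarrow> 0 < norming n"
  by (simp add: damp_pos)

lemma norming_mono: "1 \<le> m \<Longrightarrow> m \<le> n \<Longrightarrow> norming m \<le> norming n"
  by (intro mult_mono outer_mono damp_mono) (auto intro!: less_imp_le[OF damp_pos])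

lemma norming_double: "1 \<le> n \<Longrightarrow> norming (2 * n) \<le> 4 * norming n"
  using mult_mono[OF outer_double[of n] damp_double[of n]] damp_pos[of "2 * n"] by simp

lemma norming_at_top: "filterlim norming at_top sequentially"
proof (rule filterlim_at_top_mono[OF damp_at_top])
  show "\<forall>\<^sub>F n in sequentially. damp n \<le> norming n"
    using eventually_ge_at_top[of 1]
  proof eventually_elim
    case (elim n)
    have "1 \<le> outer n" using elim r_range by (intro ge_one_powr_ge_zero) auto
    then show ?case using mult_right_mono[of 1 "outer n" "damp n"] damp_pos[OF elim] by simp
  qed
qed

lemma powr_square: "real n powr (- 2 / r) * y\<^sup>2 = (y / outer n)\<^sup>2"
  by (simp add: powr_minus_divide power_divide power2_eq_square powr_add[symmetric])

text \<open>An upper bound rather than a mean: what \<open>excess_le_powr\<close> at level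
  \<open>inner k\<close> gives for the expected excess of \<open>eps k\<close>.\<close>

definition tail_mean :: "nat \<Rightarrow> real" where
  "tail_mean k = expectation (\<lambda>\<omega>. \<bar>eps 1 \<omega>\<bar> powr r) * inner k powr (1 - r)"

lemma tail_mean_nonneg: "0 \<le> tail_mean k"
  unfolding tail_mean_def by (intro mult_nonneg_nonneg integral_nonneg_AE) auto

lemma integrable_moment:
  assumes "1 \<le> k"
  shows "integrable M (\<lambda>\<omega>. \<bar>eps k \<omega>\<bar> powr r)"
    and "expectation (\<lambda>\<omega>. \<bar>eps k \<omega>\<bar> powr r) = expectation (\<lambda>\<omega>. \<bar>eps 1 \<omega>\<bar> powr r)"
proof -
  show "integrable M (\<lambda>\<omega>. \<bar>eps k \<omega>\<bar> powr r)"
    using integrable_eps[OF assms, of "\<lambda>y. \<bar>y\<bar> powr r"] moment by simp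
  show "expectation (\<lambda>\<omega>. \<bar>eps k \<omega>\<bar> powr r) = expectation (\<lambda>\<omega>. \<bar>eps 1 \<omega>\<bar> powr r)"
    by (rule expectation_eps[OF assms, of "\<lambda>y. \<bar>y\<bar> powr r"]) simp
qed

lemma expectation_le_tail_mean:
  assumes k: "1 \<le> k" and "integrable M f" and "\<And>\<omega>. f \<omega> \<le> \<bar>eps k \<omega> - clip (- inner k) (inner k) (eps k \<omega>)\<bar>"
  shows "expectation f \<le> tail_mean k"
proof -
  have "expectation f \<le> expectation (\<lambda>\<omega>. \<bar>eps k \<omega>\<bar> powr r * inner k powr (1 - r))"
    using assms(2) integrable_moment(1)[OF k] order_trans[OF assms(3) excess_le_powr[OF inner_bounds(1)[OF k] r_range(1)]]
    by (intro integral_mono integrable_mult_left)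
  then show ?thesis using integrable_moment(2)[OF k] by (simp add: tail_mean_def)
qed

context
  fixes a :: "nat \<Rightarrow> real" and C :: real
  assumes a0: "\<And>k. 0 \<le> a k" and a2: "\<And>n. (\<Sum>k=1..n. (a k)\<^sup>2) \<le> C * real n"
begin

text \<open>Since (1 - r) / r = 1 / r - 1, \<open>tail_mean k\<close> is of order k^(1/r - 1) times
  the power r - 1 of \<open>damp k\<close>. Weighted summation gives order n^(1/r) times that power
  of \<open>damp n\<close>, and dividing by the norming leaves the power r - 2, which vanishes
  because r < 2.\<close>

lemma sum_tail_mean_tendsto_0: "(\<lambda>n. (\<Sum>k=1..n. a k * tail_mean k) / norming n) \<longlonglongrightarrow> 0"
proof -
  define m where "m = expectation (\<lambda>\<omega>. \<bar>eps 1 \<omega>\<bar> powr r)"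
  define K where "K = 2 * (C + 1) / (1 - (1 / 2) powr (1 / r))"
  have m0: "0 \<le> m" unfolding m_def by (intro integral_nonneg_AE) auto
  have inner_powr: "inner k powr (1 - r) = real k powr (1 / r - 1) * damp k powr (r - 1)" if "1 \<le> k" for k
  proof -
    have "inner k powr (1 - r) = outer k powr (1 - r) / damp k powr (1 - r)"
      by (rule powr_divide)
    also have "outer k powr (1 - r) = real k powr (1 / r - 1)"
      using r_range by (simp add: powr_powr divide_simps)
    also have "real k powr (1 / r - 1) / damp k powr (1 - r) = real k powr (1 / r - 1) * damp k powr (r - 1)"
      using powr_minus_divide[of "damp k" "1 - r"] by simp
    finally show ?thesis .
  qed
  have le: "(\<Sum>k=1..n. a k * tail_mean k) / norming n \<le> m * K * damp n powr (r - 2)" if n: "1 \<le> n" for n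
  proof -
    have "(\<Sum>k=1..n. a k * tail_mean k) \<le> (\<Sum>k=1..n. m * damp n powr (r - 1) * (a k * real k powr (1 / r - 1)))"
    proof (rule sum_mono)
      fix k assume k: "k \<in> {1..n}"
      then have "damp k powr (r - 1) \<le> damp n powr (r - 1)"
        using r_range damp_mono[of k n] damp_pos[of k] by (intro powr_mono2) auto
      then have "(m * (a k * real k powr (1 / r - 1))) * damp k powr (r - 1)
          \<le> (m * (a k * real k powr (1 / r - 1))) * damp n powr (r - 1)"
        using m0 a0[of k] by (intro mult_left_mono) auto
      then show "a k * tail_mean k \<le> m * damp n powr (r - 1) * (a k * real k powr (1 / r - 1))"
        using k by (simp only: tail_mean_def m_def[symmetric] inner_powr atLeastAtMost_iff mult_ac)
    qed
    also have "\<dots> = m * damp n powr (r - 1) * (\<Sum>k=1..n. a k * real k powr (1 / r - 1))"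
      by (simp add: sum_distrib_left)
    also have "\<dots> \<le> m * damp n powr (r - 1) * (K * outer n)"
      unfolding K_def using m0 r_range
      by (intro mult_left_mono weighted_sum_powr_le a0 sum_le_of_sum_squares_le a2) auto
    finally have "(\<Sum>k=1..n. a k * tail_mean k) / norming n \<le> m * damp n powr (r - 1) * (K * outer n) / norming n"
      using norming_pos[OF n] by (intro divide_right_mono) auto
    also have "\<dots> = m * K * (damp n powr (r - 1) / damp n)"
      using n damp_pos[OF n] by (simp add: field_simps)
    also have "damp n powr (r - 1) / damp n = damp n powr (r - 2)"
      using damp_pos[OF n] powr_diff[of "damp n" "r - 1" 1] by simp
    finally show ?thesis .
  qed
  have lim: "(\<lambda>n. m * K * damp n powr (r - 2)) \<longlonglongrightarrow> 0"
    using r_range by (intro tendsto_mult_right_zero tendsto_neg_powr damp_at_top) auto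
  show ?thesis
  proof (rule tendsto_sandwich[OF _ _ tendsto_const lim])
    show "\<forall>\<^sub>F n in sequentially. 0 \<le> (\<Sum>k=1..n. a k * tail_mean k) / norming n"
      using eventually_ge_at_top[of 1]
    proof eventually_elim
      case (elim n)
      then show ?case using a0 tail_mean_nonneg less_imp_le[OF damp_pos[OF elim]]
        by (intro divide_nonneg_nonneg sum_nonneg mult_nonneg_nonneg) auto
    qed
    show "\<forall>\<^sub>F n in sequentially. (\<Sum>k=1..n. a k * tail_mean k) / norming n \<le> m * K * damp n powr (r - 2)"
      using eventually_ge_at_top[of 1] by eventually_elim (rule le)
  qed
qed

lemma sum_le_tail_mean_tendsto_0:
  assumes "\<And>k. 1 \<le> k \<Longrightarrow> \<bar>\<mu> k\<bar> \<le> tail_mean k"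
  shows "(\<lambda>n. (\<Sum>k=1..n. a k * \<mu> k) / norming n) \<longlonglongrightarrow> 0"
proof (rule Lim_null_comparison[OF _ sum_tail_mean_tendsto_0])
  show "\<forall>\<^sub>F n in sequentially. norm ((\<Sum>k=1..n. a k * \<mu> k) / norming n) \<le> (\<Sum>k=1..n. a k * tail_mean k) / norming n"
    using eventually_ge_at_top[of 1]
  proof eventually_elim
    case (elim n)
    have "\<bar>\<Sum>k=1..n. a k * \<mu> k\<bar> \<le> (\<Sum>k=1..n. a k * tail_mean k)"
      using assms a0 by (intro order_trans[OF sum_abs] sum_mono) (auto simp: abs_mult intro!: mult_left_mono)
    then show ?case using norming_pos[OF elim] by (simp add: divide_right_mono)
  qed
qed

text \<open>The maximal inequality loses (m + 2)^2 on indices up to 2^(m+1); this is absorbed by the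
  square of \<open>damp (2 ^ m)\<close>, the squared ratio of \<open>norming\<close> to
  \<open>outer\<close>.\<close>

lemma clip_sum_inner_tendsto_0:
  assumes G: "summable (\<lambda>l. real l powr (- 2 / r) * (\<Sum>k\<in>{1..<l}. a k * a l * G_cov M (eps k) (eps l) (inner l)))"
  shows "AE \<omega> in M. (\<lambda>n. clip_sum a (\<lambda>k. - inner k) inner n \<omega> / norming n) \<longlonglongrightarrow> 0"
proof -
  let ?S = "clip_sum a (\<lambda>k. - inner k) inner"
  have "AE \<omega> in M. \<exists>g. g \<longlonglongrightarrow> 0 \<and> (\<forall>m n. n \<le> 2 ^ m \<longrightarrow>
      real (2 ^ m) powr (- 2 / r) * (?S n \<omega>)\<^sup>2 \<le> (real (Suc m))\<^sup>2 * g m)"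
  proof (rule AE_max_tendsto_0[OF a0 a2 _ _ powr_anti powr_half _ _ inner_mono _ G])
    fix n :: nat assume n: "1 \<le> n"
    show "0 \<le> inner n" "inner n \<le> outer n" "- inner n \<le> - inner n \<and> - inner n \<le> inner n \<and> inner n \<le> inner n"
      using inner_bounds[OF n] by simp_all
  qed simp_all
  then show ?thesis
  proof eventually_elim
    case (elim \<omega>)
    then obtain g where g: "g \<longlonglongrightarrow> 0"
      and le: "\<And>m n. n \<le> 2 ^ m \<Longrightarrow> real (2 ^ m) powr (- 2 / r) * (?S n \<omega>)\<^sup>2 \<le> (real (Suc m))\<^sup>2 * g m" by blast
    show ?case
    proof (rule tendsto_0_of_dyadic_bound)
      \<comment> \<open>One factor 2 compares m + 2 with \<open>damp (2 ^ m)\<close>, using ln 2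
        \<ge> 1/2; the other is the doubling of \<open>outer\<close>.\<close>
      show "(\<lambda>m. 4 * sqrt (g (Suc m))) \<longlonglongrightarrow> 0"
        using tendsto_mult_right_zero[OF tendsto_real_sqrt[OF LIMSEQ_Suc[OF g], simplified], of 4] .
      fix m n :: nat assume mn: "2 ^ m \<le> n" "n < 2 ^ Suc m"
      have n: "1 \<le> n" using mn(1) order_trans[OF one_le_power[of "2::nat" m]] by simp
      have "(?S n \<omega> / outer (2 ^ Suc m))\<^sup>2 \<le> (real (Suc (Suc m)))\<^sup>2 * g (Suc m)"
        using le[of n "Suc m"] mn unfolding powr_square by simp
      from real_sqrt_le_mono[OF this]
      have "\<bar>?S n \<omega> / outer (2 ^ Suc m)\<bar> \<le> real (Suc (Suc m)) * sqrt (g (Suc m))"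
        by (simp only: real_sqrt_mult real_sqrt_abs abs_of_nat)
      then have "\<bar>?S n \<omega>\<bar> \<le> real (Suc (Suc m)) * sqrt (g (Suc m)) * outer (2 ^ Suc m)"
        by (simp add: pos_divide_le_eq del: of_nat_Suc power_Suc)
      also have "\<dots> \<le> (2 * damp (2 ^ m)) * sqrt (g (Suc m)) * (2 * outer (2 ^ m))"
      proof (intro mult_mono)
        show "real (Suc (Suc m)) \<le> 2 * damp (2 ^ m)"
          using mult_left_mono[OF half_le_ln_2, of "real m"] by (simp add: damp_def ln_realpow)
        show "outer (2 ^ Suc m) \<le> 2 * outer (2 ^ m)" using outer_double[of "2 ^ m"] by simp
        \<comment> \<open>Nonnegativity of g is read off from the maximal bound at n = 0.\<close>
        have "0 \<le> (real (Suc (Suc m)))\<^sup>2 * g (Suc m)"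
          by (rule order_trans[OF _ le[of 0 "Suc m"]]) auto
        then show "0 \<le> sqrt (g (Suc m))" by (simp add: zero_le_mult_iff)
        then show "0 \<le> 2 * damp (2 ^ m) * sqrt (g (Suc m))"
          using damp_pos[of "2 ^ m"] by simp
      qed (use damp_pos[of "2 ^ m"] in auto)
      also have "\<dots> = 4 * sqrt (g (Suc m)) * norming (2 ^ m)" by simp
      also have "\<dots> \<le> 4 * sqrt (g (Suc m)) * norming n"
      proof (intro mult_left_mono norming_mono mn)
        have "0 \<le> (real (Suc (Suc m)))\<^sup>2 * g (Suc m)"
          by (rule order_trans[OF _ le[of 0 "Suc m"]]) auto
        then show "0 \<le> 4 * sqrt (g (Suc m))" by (simp add: zero_le_mult_iff)
      qed auto
      finally show "\<bar>?S n \<omega> / norming n\<bar> \<le> 4 * sqrt (g (Suc m))"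
        using norming_pos[OF n] by (simp add: pos_divide_le_eq abs_divide)
    qed
  qed
qed

text \<open>s is a sign and d the endpoint from which a clip is measured, so one statement treats
  the upper tail (s = 1, d = \<open>inner\<close>) and the lower tail (s = -1, d =
  \<open>- inner\<close>). The partial sums increase in n and their means are already negligible,
  which is why powers of two are dense enough.\<close>

lemma sum_excess_tendsto_0:
  assumes G: "summable (\<lambda>l. real l powr (- 2 / r) / (damp l)\<^sup>2 *
      (\<Sum>k\<in>{1..<l}. a k * a l * G_cov M (eps k) (eps l) (outer l)))"
    and uv: "\<And>n. 1 \<le> n \<Longrightarrow> - outer n \<le> u n \<and> u n \<le> v n \<and> v n \<le> outer n"
    and s: "\<bar>s\<bar> = 1"
    and h0: "\<And>k y. 1 \<le> k \<Longrightarrow> 0 \<le> s * (clip (u k) (v k) y - d k)"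
    and h1: "\<And>k y. 1 \<le> k \<Longrightarrow> s * (clip (u k) (v k) y - d k) \<le> \<bar>y - clip (- inner k) (inner k) y\<bar>"
  shows "AE \<omega> in M. (\<lambda>n. (\<Sum>k=1..n. a k * (s * (clipped u v k \<omega> - d k))) / norming n) \<longlonglongrightarrow> 0"
proof -
  let ?w = "\<lambda>n. real n powr (- 2 / r) / (damp n)\<^sup>2"
  let ?m = "\<lambda>k. s * (expectation (clipped u v k) - d k)"
  have int: "integrable M (clipped u v k)" if "1 \<le> k" for k
    unfolding clipped_def[abs_def] using uv[OF that] by (intro integrable_clip) auto
  have m_eq: "?m k = expectation (\<lambda>\<omega>. s * (clipped u v k \<omega> - d k))" if "1 \<le> k" for k
    using int[OF that] by (simp add: prob_space)
  have "\<bar>?m k\<bar> \<le> tail_mean k" if k: "1 \<le> k" for k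
  proof -
    have "0 \<le> ?m k"
      unfolding m_eq[OF k] using h0[OF k] by (intro integral_nonneg_AE) (auto simp: clipped_def)
    moreover have "?m k \<le> tail_mean k"
      unfolding m_eq[OF k]
    proof (rule expectation_le_tail_mean[OF k])
      show "integrable M (\<lambda>\<omega>. s * (clipped u v k \<omega> - d k))" using int[OF k] by simp
    qed (unfold clipped_def, rule h1[OF k])
    ultimately show ?thesis by simp
  qed
  then have mean: "(\<lambda>n. (\<Sum>k=1..n. a k * ?m k) / norming n) \<longlonglongrightarrow> 0"
    by (rule sum_le_tail_mean_tendsto_0)
  have pow: "filterlim (\<lambda>j. 2 ^ j :: nat) at_top sequentially"
    by (rule filterlim_subseq) (auto simp: strict_mono_def)
  have "AE \<omega> in M. (\<lambda>j. ?w (1 * 2 ^ j) * (clip_sum a u v (1 * 2 ^ j) \<omega>)\<^sup>2) \<longlonglongrightarrow> 0"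
  proof (rule AE_dyadic_tendsto_0[OF a0 a2 _ _ _ _ _ _ _ uv G])
    show "?w n \<le> real n powr (- 2 / r)" if "1 \<le> n" for n
    proof -
      have "1 \<le> (damp n)\<^sup>2" using damp_ge_2[OF that] by (intro one_le_power) simp
      then have "?w n \<le> real n powr (- 2 / r) / 1" by (intro divide_left_mono) auto
      then show ?thesis by simp
    qed
    show "?w n \<le> ?w m" if "1 \<le> m" "m \<le> n" for m n
      using that damp_pos[of m] by (intro frac_le powr_anti power_mono damp_mono) auto
    show "?w (2 * n) \<le> ?w n / 2" if n: "1 \<le> n" for n
    proof -
      have "?w (2 * n) \<le> (real n powr (- 2 / r) / 2) / (damp n)\<^sup>2"
        using n damp_pos[OF n] by (intro frac_le powr_half power_mono damp_mono) auto
      then show ?thesis by simp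
    qed
    show "outer m \<le> outer n" if "m \<le> n" for m n by (rule outer_mono[OF that])
  qed auto
  then show ?thesis
  proof eventually_elim
    case (elim \<omega>)
    let ?P = "\<lambda>n. \<Sum>k=1..n. a k * (s * (clipped u v k \<omega> - d k))"
    \<comment> \<open>Uncentring: the increasing sum is its centred version, small along powers of
      two by second moments, plus negligible means.\<close>
    have P_eq: "?P n = s * clip_sum a u v n \<omega> + (\<Sum>k=1..n. a k * ?m k)" for n
      unfolding clip_sum_def sum_distrib_left sum.distrib[symmetric]
      by (intro sum.cong) (auto simp: algebra_simps)
    have w_eq: "?w n * y\<^sup>2 = (y / norming n)\<^sup>2" for n y
    proof -
      have "?w n * y\<^sup>2 = (real n powr (- 2 / r) * y\<^sup>2) / (damp n)\<^sup>2" by simp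
      also have "\<dots> = (y / outer n)\<^sup>2 / (damp n)\<^sup>2" by (simp only: powr_square)
      finally show ?thesis by (simp add: power_divide power_mult_distrib)
    qed
    have "(\<lambda>j. (clip_sum a u v (2 ^ j) \<omega> / norming (2 ^ j))\<^sup>2) \<longlonglongrightarrow> 0"
      using elim unfolding w_eq mult_1 .
    then have S: "(\<lambda>j. clip_sum a u v (2 ^ j) \<omega> / norming (2 ^ j)) \<longlonglongrightarrow> 0"
      by (rule tendsto_0_of_square)
    have P0: "0 \<le> a k * (s * (clipped u v k \<omega> - d k))" if "1 \<le> k" for k
      using a0 h0[OF that] by (simp add: clipped_def)
    have eq: "(\<lambda>j. ?P (2 ^ j) / norming (2 ^ j)) = (\<lambda>j. s * (clip_sum a u v (2 ^ j) \<omega> / norming (2 ^ j))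
        + (\<Sum>k=1..2 ^ j. a k * ?m k) / norming (2 ^ j))"
      by (simp only: P_eq add_divide_distrib times_divide_eq_right)
    have lim: "(\<lambda>j. ?P (2 ^ j) / norming (2 ^ j)) \<longlonglongrightarrow> 0"
      unfolding eq using tendsto_add[OF tendsto_mult_right_zero[OF S, of s] filterlim_compose[OF mean pow]]
      by (simp only: add_0_right)
    show ?case
    proof (rule tendsto_0_of_dyadic_mono[OF _ _ norming_pos norming_mono norming_double lim])
      show "0 \<le> ?P n" for n by (intro sum_nonneg P0) auto
      show "?P m \<le> ?P n" if "m \<le> n" for m n using that by (intro sum_mono2 P0) auto
    qed
  qed
qed

lemma slln_higher_moment:
  assumes int1: "integrable M (eps 1)" and mean0: "expectation (eps 1) = 0"
    and G_inner: "summable (\<lambda>l. real l powr (- 2 / r) *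
      (\<Sum>k\<in>{1..<l}. a k * a l * G_cov M (eps k) (eps l) (inner l)))"
    and G_outer: "summable (\<lambda>l. real l powr (- 2 / r) / (damp l)\<^sup>2 *
      (\<Sum>k\<in>{1..<l}. a k * a l * G_cov M (eps k) (eps l) (outer l)))"
  shows "AE \<omega> in M. (\<lambda>n. (\<Sum>k=1..n. a k * eps k \<omega>) / norming n) \<longlonglongrightarrow> 0"
proof -
  let ?m = "\<lambda>k. expectation (clipped (\<lambda>k. - inner k) inner k)"
  have "\<bar>?m k\<bar> \<le> tail_mean k" if k: "1 \<le> k" for k
  proof -
    have int: "integrable M (eps k)" and mean: "expectation (eps k) = 0"
      using integrable_eps[OF k, of "\<lambda>y. y"] int1 expectation_eps[OF k, of "\<lambda>y. y"] mean0
      by simp_all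
    have int_c: "integrable M (clipped (\<lambda>k. - inner k) inner k)"
      unfolding clipped_def[abs_def] using inner_bounds(1)[OF k] by (intro integrable_clip meas) linarith
    \<comment> \<open>As \<open>eps k\<close> has mean 0, the mean of its clip is minus the mean
      excess, which \<open>tail_mean k\<close> bounds.\<close>
    have eq: "?m k = expectation (\<lambda>\<omega>. clipped (\<lambda>k. - inner k) inner k \<omega> - eps k \<omega>)"
      by (simp only: Bochner_Integration.integral_diff[OF int_c int] mean diff_0_right)
    have "\<bar>?m k\<bar> \<le> expectation (\<lambda>\<omega>. \<bar>clipped (\<lambda>k. - inner k) inner k \<omega> - eps k \<omega>\<bar>)"
      unfolding eq by (rule integral_abs_bound)
    also have "\<dots> \<le> tail_mean k"
    proof (rule expectation_le_tail_mean[OF k])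
      show "integrable M (\<lambda>\<omega>. \<bar>clipped (\<lambda>k. - inner k) inner k \<omega> - eps k \<omega>\<bar>)"
        by (intro integrable_abs Bochner_Integration.integrable_diff int int_c)
      show "\<bar>clipped (\<lambda>k. - inner k) inner k \<omega> - eps k \<omega>\<bar>
          \<le> \<bar>eps k \<omega> - clip (- inner k) (inner k) (eps k \<omega>)\<bar>" for \<omega>
        unfolding clipped_def by (subst abs_minus_commute) (rule order_refl)
    qed
    finally show ?thesis .
  qed
  then have mean: "(\<lambda>n. (\<Sum>k=1..n. a k * ?m k) / norming n) \<longlonglongrightarrow> 0"
    by (rule sum_le_tail_mean_tendsto_0)
  have pos: "AE \<omega> in M. (\<lambda>n. (\<Sum>k=1..n. a k * (1 * (clipped inner outer k \<omega> - inner k))) / norming n) \<longlonglongrightarrow> 0"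
  proof (rule sum_excess_tendsto_0[OF G_outer, where s = 1 and u = inner and v = outer and d = inner])
    fix k :: nat and y :: real assume k: "1 \<le> k"
    note b = inner_bounds[OF k]
    show "- outer k \<le> inner k \<and> inner k \<le> outer k \<and> outer k \<le> outer k"
      using b by (intro conjI) linarith+
    show "0 \<le> 1 * (clip (inner k) (outer k) y - inner k)"
      "1 * (clip (inner k) (outer k) y - inner k) \<le> \<bar>y - clip (- inner k) (inner k) y\<bar>"
      unfolding mult_1 by (rule excess_parts[OF b])+
  qed simp
  have neg: "AE \<omega> in M. (\<lambda>n. (\<Sum>k=1..n. a k *
      (- 1 * (clipped (\<lambda>k. - outer k) (\<lambda>k. - inner k) k \<omega> - (- inner k)))) / norming n) \<longlonglongrightarrow> 0"
  proof (rule sum_excess_tendsto_0[OF G_outer, where s = "- 1" and u = "\<lambda>k. - outer k" and v = "\<lambda>k. - inner k"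
        and d = "\<lambda>k. - inner k"])
    fix k :: nat and y :: real assume k: "1 \<le> k"
    note b = inner_bounds[OF k]
    have eq: "- 1 * (z - (- inner k)) = - inner k - z" for z by simp
    show "- outer k \<le> - outer k \<and> - outer k \<le> - inner k \<and> - inner k \<le> outer k"
      using b by (intro conjI) linarith+
    show "0 \<le> - 1 * (clip (- outer k) (- inner k) y - (- inner k))"
      "- 1 * (clip (- outer k) (- inner k) y - (- inner k)) \<le> \<bar>y - clip (- inner k) (inner k) y\<bar>"
      unfolding eq by (rule excess_parts[OF b])+
  qed simp
  show ?thesis
    using AE_slln_truncation[OF norming_at_top, of a] clip_sum_inner_tendsto_0[OF G_inner] pos neg
  proof eventually_elim
    case (elim \<omega>)
    have eq: "(\<Sum>k=1..n. a k * eps k \<omega>) = (\<Sum>k=1..n. a k * (eps k \<omega> - clip (- outer k) (outer k) (eps k \<omega>)))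
      + clip_sum a (\<lambda>k. - inner k) inner n \<omega>
      + (\<Sum>k=1..n. a k * (1 * (clipped inner outer k \<omega> - inner k)))
      - (\<Sum>k=1..n. a k * (- 1 * (clipped (\<lambda>k. - outer k) (\<lambda>k. - inner k) k \<omega> - (- inner k))))
      + (\<Sum>k=1..n. a k * ?m k)" for n
      unfolding clip_sum_def sum.distrib[symmetric] sum_subtractf[symmetric]
    proof (intro sum.cong refl)
      fix k assume "k \<in> {1..n}"
      then have b: "0 < inner k" "inner k \<le> outer k" using inner_bounds[of k] by auto
      \<comment> \<open>The constants from the cut points \<open>- inner k\<close> and
        \<open>inner k\<close> cancel, as do the endpoints from which the two tails are
        measured.\<close>
      have c: "clip (- outer k) (outer k) (eps k \<omega>) = clip (- outer k) (- inner k) (eps k \<omega>)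
          + clip (- inner k) (inner k) (eps k \<omega>) + clip (inner k) (outer k) (eps k \<omega>)"
        using clip_add[of "- outer k" "- inner k" "outer k"] clip_add[of "- inner k" "inner k" "outer k"] b by simp
      show "a k * eps k \<omega> = a k * (eps k \<omega> - clip (- outer k) (outer k) (eps k \<omega>))
        + a k * (clipped (\<lambda>k. - inner k) inner k \<omega> - ?m k)
        + a k * (1 * (clipped inner outer k \<omega> - inner k))
        - a k * (- 1 * (clipped (\<lambda>k. - outer k) (\<lambda>k. - inner k) k \<omega> - (- inner k)))
        + a k * ?m k"
        unfolding c clipped_def by (simp add: algebra_simps)
    qed
    have "(\<lambda>n. (\<Sum>k=1..n. a k * eps k \<omega>) / norming n) = (\<lambda>n.
      (\<Sum>k=1..n. a k * (eps k \<omega> - clip (- outer k) (outer k) (eps k \<omega>))) / norming n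
      + clip_sum a (\<lambda>k. - inner k) inner n \<omega> / norming n
      + (\<Sum>k=1..n. a k * (1 * (clipped inner outer k \<omega> - inner k))) / norming n
      - (\<Sum>k=1..n. a k * (- 1 * (clipped (\<lambda>k. - outer k) (\<lambda>k. - inner k) k \<omega> - (- inner k)))) / norming n
      + (\<Sum>k=1..n. a k * ?m k) / norming n)"
      by (simp only: eq add_divide_distrib diff_divide_distrib)
    then show ?case
      using tendsto_add[OF tendsto_diff[OF tendsto_add[OF tendsto_add[OF elim(1,2)] elim(3)] elim(4)] mean]
      by (simp only: add_0_right diff_0_right)
  qed
qed

end

end

section \<open>The least-squares estimator\<close>

text \<open>Multiplying X'X B = 1 by B' from the left gives B' X'X B = B', so the entries of B are
  inner products of the columns of X B. Symmetry of B comes with it.\<close>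

lemma matrix_inv_XtX_entry:
  assumes "invertible (XtX x n)"
  defines "B \<equiv> matrix_inv (XtX x n)"
  shows "B $ j $ i = (\<Sum>k=1..n. (\<Sum>m\<in>UNIV. x k m * B $ m $ i) * (\<Sum>m\<in>UNIV. x k m * B $ m $ j))"
proof -
  have "XtX x n ** B = mat 1"
    using assms(1) someI_ex[of "\<lambda>A'. XtX x n ** A' = mat 1 \<and> A' ** XtX x n = mat 1"]
    unfolding B_def matrix_inv_def invertible_def by blast
  then have inv: "(\<Sum>q\<in>UNIV. (\<Sum>k=1..n. x k m * x k q) * B $ q $ j) = (if m = j then 1 else 0)" for m
    by (simp add: vec_eq_iff matrix_matrix_mult_def XtX_def mat_def)
  have "(\<Sum>k=1..n. (\<Sum>m\<in>UNIV. x k m * B $ m $ i) * (\<Sum>q\<in>UNIV. x k q * B $ q $ j)) =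
      (\<Sum>k=1..n. \<Sum>m\<in>UNIV. \<Sum>q\<in>UNIV. B $ m $ i * (x k m * x k q * B $ q $ j))"
    by (simp add: sum_product mult_ac)
  also have "\<dots> = (\<Sum>m\<in>UNIV. \<Sum>q\<in>UNIV. \<Sum>k=1..n. B $ m $ i * (x k m * x k q * B $ q $ j))"
    by (subst sum.swap) (rule sum.cong[OF refl sum.swap])
  also have "\<dots> = (\<Sum>m\<in>UNIV. B $ m $ i * (\<Sum>q\<in>UNIV. (\<Sum>k=1..n. x k m * x k q) * B $ q $ j))"
    by (simp add: sum_distrib_left sum_distrib_right)
  also have "\<dots> = B $ j $ i" by (simp only: inv) (simp add: if_distrib cong: if_cong)
  finally show ?thesis by simp
qed

text \<open>In the Gram representation this is 2|pq| \<le> p^2 + q^2 summed over k. It lets the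
  diagonal rates control every entry.\<close>

lemma abs_matrix_inv_XtX_le:
  assumes "invertible (XtX x n)"
  defines "B \<equiv> matrix_inv (XtX x n)"
  shows "2 * \<bar>B $ i $ j\<bar> \<le> B $ i $ i + B $ j $ j"
proof -
  let ?p = "\<lambda>i k. \<Sum>m\<in>UNIV. x k m * B $ m $ i"
  have B: "B $ i $ j = (\<Sum>k=1..n. ?p j k * ?p i k)" for i j
    unfolding B_def by (rule matrix_inv_XtX_entry[OF assms(1)])
  have "2 * \<bar>B $ i $ j\<bar> \<le> (\<Sum>k=1..n. 2 * \<bar>?p j k * ?p i k\<bar>)"
    unfolding B[of i j] sum_distrib_left[symmetric] by (intro mult_left_mono sum_abs) simp
  also have "\<dots> \<le> (\<Sum>k=1..n. ?p i k * ?p i k + ?p j k * ?p j k)"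
  proof (intro sum_mono)
    fix k
    show "2 * \<bar>?p j k * ?p i k\<bar> \<le> ?p i k * ?p i k + ?p j k * ?p j k"
      using zero_le_power2[of "\<bar>?p i k\<bar> - \<bar>?p j k\<bar>"]
      by (simp add: power2_eq_square abs_mult algebra_simps)
  qed
  also have "\<dots> = B $ i $ i + B $ j $ j" by (simp only: B[of i i] B[of j j] sum.distrib)
  finally show ?thesis .
qed

text \<open>b is shared by the rate of the inverse matrix and the law of large numbers: each
  coordinate of the error is a finite sum of products of an O(1 / b n) entry and an o(b n)
  sum.\<close>

lemma lse_tendsto:
  fixes x :: "nat \<Rightarrow> 'p::finite \<Rightarrow> real" and b :: "nat \<Rightarrow> real"
  assumes nonsing: "\<exists>n0. \<forall>n\<ge>n0. invertible (XtX x n)"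
    and b: "\<And>n. 1 \<le> n \<Longrightarrow> 0 < b n"
    and diag: "\<And>j. (\<lambda>n. matrix_inv (XtX x n) $ j $ j) \<in> O(\<lambda>n. 1 / b n)"
    and S: "\<And>j. (\<lambda>n. (\<Sum>k=1..n. x k j * eps k \<omega>) / b n) \<longlonglongrightarrow> 0"
  shows "(\<lambda>n. lse x \<beta> eps n \<omega>) \<longlonglongrightarrow> \<beta>"
proof (rule vec_tendstoI)
  fix i
  let ?B = "\<lambda>n. matrix_inv (XtX x n)" and ?S = "\<lambda>j n. \<Sum>k=1..n. x k j * eps k \<omega>"
  have "(\<lambda>n. ?B n $ i $ j * ?S j n) \<longlonglongrightarrow> 0" for j
  proof -
    obtain c where c: "\<forall>\<^sub>F n in sequentially. norm (?B n $ i $ i) \<le> c * norm (1 / b n)"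
      using landau_o.bigE[OF diag[of i]] by blast
    obtain d where d: "\<forall>\<^sub>F n in sequentially. norm (?B n $ j $ j) \<le> d * norm (1 / b n)"
      using landau_o.bigE[OF diag[of j]] by blast
    have ns: "\<forall>\<^sub>F n in sequentially. invertible (XtX x n)"
      using nonsing by (simp add: eventually_sequentially)
    have "(\<lambda>n. (c + d) * \<bar>?S j n / b n\<bar>) \<longlonglongrightarrow> 0"
      using tendsto_mult_right_zero[OF tendsto_rabs_zero[OF S[of j]]] .
    then show ?thesis
    proof (rule Lim_null_comparison[rotated])
      show "\<forall>\<^sub>F n in sequentially. norm (?B n $ i $ j * ?S j n) \<le> (c + d) * \<bar>?S j n / b n\<bar>"
        using c d ns eventually_ge_at_top[of 1]
      proof eventually_elim
        case (elim n)
        have "2 * \<bar>?B n $ i $ j\<bar> \<le> (c + d) / b n"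
          using abs_matrix_inv_XtX_le[OF elim(3), of i j] elim(1,2) b[OF elim(4)]
          by (simp add: add_divide_distrib)
        then have "\<bar>?B n $ i $ j\<bar> \<le> (c + d) / b n" by linarith
        then have "\<bar>?B n $ i $ j\<bar> * \<bar>?S j n\<bar> \<le> (c + d) / b n * \<bar>?S j n\<bar>"
          by (rule mult_right_mono) simp
        then show ?case using b[OF elim(4)] by (simp add: abs_mult abs_divide)
      qed
    qed
  qed
  then have "(\<lambda>n. \<beta> $ i + (\<Sum>j\<in>UNIV. ?B n $ i $ j * ?S j n)) \<longlonglongrightarrow> \<beta> $ i + (\<Sum>j\<in>(UNIV :: 'p set). 0)"
    by (intro tendsto_add tendsto_const tendsto_sum)
  then show "(\<lambda>n. lse x \<beta> eps n \<omega> $ i) \<longlonglongrightarrow> \<beta> $ i"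
    by (simp add: lse_def matrix_vector_mult_def)
qed

lemma signed_weights_tendsto_0:
  fixes y e b :: "nat \<Rightarrow> real"
  assumes "(\<lambda>n. (\<Sum>k=1..n. max 0 (y k) * e k) / b n) \<longlonglongrightarrow> 0"
    and "(\<lambda>n. (\<Sum>k=1..n. max 0 (- y k) * e k) / b n) \<longlonglongrightarrow> 0"
  shows "(\<lambda>n. (\<Sum>k=1..n. y k * e k) / b n) \<longlonglongrightarrow> 0"
proof -
  have "y k * e k = max 0 (y k) * e k - max 0 (- y k) * e k" for k
    by (simp add: max_def)
  then have "(\<lambda>n. (\<Sum>k=1..n. y k * e k) / b n) =
      (\<lambda>n. (\<Sum>k=1..n. max 0 (y k) * e k) / b n - (\<Sum>k=1..n. max 0 (- y k) * e k) / b n)"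
    by (simp only: sum_subtractf diff_divide_distrib)
  then show ?thesis using tendsto_diff[OF assms] by simp
qed

section \<open>Logarithms, kernel windows and the two laws for a design column\<close>

lemma LogF_ge_1: "1 \<le> LogF t"
proof -
  have "ln (exp 1) \<le> ln (max \<bar>t\<bar> (exp 1))"
    by (subst ln_le_cancel_iff) (auto simp: less_max_iff_disj)
  then show ?thesis by (simp add: LogF_def)
qed

text \<open>Serves on the window [s, 2 s] with s \<le> l: there ln t \<le> ln 2 + ln l, and the
  least value 1 of \<open>LogF\<close> is below 2.\<close>

lemma LogF_le_damp:
  assumes "1 \<le> l" "0 < t" "t \<le> 2 * real l"
  shows "LogF t \<le> damp l"
proof (cases "t \<le> exp 1")
  case True
  then have "LogF t = 1" using assms by (simp add: LogF_def)
  then show ?thesis using damp_ge_2[OF assms(1)] by simp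
next
  case False
  then have "LogF t = ln t" using assms by (simp add: LogF_def)
  also have "\<dots> \<le> ln (2 * real l)" using assms by simp
  also have "\<dots> \<le> damp l" using assms ln_2_le_1 by (simp add: damp_def ln_mult)
  finally show ?thesis .
qed

lemma damp_le_LogF:
  assumes "1 \<le> n"
  shows "damp n \<le> 3 * LogF (real n)"
proof -
  have "ln (real n) \<le> LogF (real n)"
    unfolding LogF_def using assms by (subst ln_le_cancel_iff) (auto simp: less_max_iff_disj)
  then show ?thesis using LogF_ge_1[of "real n"] by (simp add: damp_def)
qed

text \<open>On the window t^3 is at most 8 s^3 and \<open>LogF t\<close> at most
  \<open>damp l\<close>, which bounds the first summand of the kernel from below by the left side;
  the second summand only adds to it.\<close>

lemma weight_le_kernel:
  assumes "1 \<le> l" "0 < s" "s \<le> real l" "s \<le> t" "t \<le> 2 * s"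
  shows "(1 / (s * damp l))\<^sup>2 / (8 * s) \<le>
    1 / (t ^ 3 * (LogF t)\<^sup>2) + 1 / (max t (exp 1) * t ^ 2 * (LogF t) ^ 3)"
proof -
  have L: "1 \<le> LogF t" "LogF t \<le> damp l"
    using LogF_ge_1 LogF_le_damp[of l t] assms by auto
  have "t ^ 3 * (LogF t)\<^sup>2 \<le> (2 * s) ^ 3 * (damp l)\<^sup>2"
    using assms L by (intro mult_mono power_mono) auto
  moreover have "0 < t ^ 3 * (LogF t)\<^sup>2" using assms L by simp
  ultimately have "1 / ((2 * s) ^ 3 * (damp l)\<^sup>2) \<le> 1 / (t ^ 3 * (LogF t)\<^sup>2)"
    using assms L by (intro divide_left_mono mult_pos_pos) auto
  moreover have "(1 / (s * damp l))\<^sup>2 / (8 * s) = 1 / ((2 * s) ^ 3 * (damp l)\<^sup>2)"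
    by (simp add: power2_eq_square power3_eq_cube divide_simps)
  moreover have "0 \<le> 1 / (max t (exp 1) * t ^ 2 * (LogF t) ^ 3)"
    using assms L by (intro divide_nonneg_nonneg mult_nonneg_nonneg) auto
  ultimately show ?thesis by linarith
qed

lemma eventually_damp_le_ln_powr:
  assumes "1 < p"
  shows "\<forall>\<^sub>F l in sequentially. K * damp l \<le> ln (real l) powr p"
  unfolding damp_def using assms by real_asymp

context pqd_sequence
begin

lemma integrable_eps_1: "integrable M (eps 1)"
proof (rule Bochner_Integration.integrable_bound)
  show "integrable M (\<lambda>\<omega>. 1 + \<bar>eps 1 \<omega>\<bar> powr r)"
    using moment by simp
  show "AE \<omega> in M. norm (eps 1 \<omega>) \<le> norm (1 + \<bar>eps 1 \<omega>\<bar> powr r)"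
  proof (rule AE_I2)
    fix \<omega>
    show "norm (eps 1 \<omega>) \<le> norm (1 + \<bar>eps 1 \<omega>\<bar> powr r)"
    proof (cases "\<bar>eps 1 \<omega>\<bar> \<le> 1")
      case True
      then show ?thesis using powr_ge_zero[of "\<bar>eps 1 \<omega>\<bar>" r] by (simp add: add_increasing2)
    next
      case False
      then have "\<bar>eps 1 \<omega>\<bar> powr 1 \<le> \<bar>eps 1 \<omega>\<bar> powr r" using r_range by (intro powr_mono) auto
      then show ?thesis using False by simp
    qed
  qed
qed measurable

text \<open>Eventually \<open>lam l\<close> is at most (C + 1) l^(1/r) / Log^(2/r) l, and since 2 /
  r > 1 this power of the logarithm outgrows \<open>(C + 1) * damp l\<close>. Hence the window that
  starts at \<open>inner l\<close> lies in the range of integration.\<close>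

lemma eventually_lam_le_inner:
  assumes "0 < C"
    and lam: "(\<lambda>l. lam l - C * (real l powr (1 / r) / LogF (real l) powr (2 / r)))
      \<in> o(\<lambda>l. real l powr (1 / r) / LogF (real l) powr (2 / r))"
  shows "\<forall>\<^sub>F l in sequentially. lam l \<le> inner l"
proof -
  let ?f = "\<lambda>l. real l powr (1 / r) / LogF (real l) powr (2 / r)"
  have "\<forall>\<^sub>F l in sequentially. norm (lam l - C * ?f l) \<le> 1 * norm (?f l)"
    by (rule landau_o.smallD[OF lam]) simp
  moreover have "\<forall>\<^sub>F l in sequentially. (C + 1) * damp l \<le> ln (real l) powr (2 / r)"
    using r_range by (intro eventually_damp_le_ln_powr) auto
  \<comment> \<open>From 3 on the index exceeds e, so \<open>LogF\<close> is the plain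
    logarithm.\<close>
  ultimately show ?thesis using eventually_ge_at_top[of 3]
  proof eventually_elim
    case (elim l)
    have "exp 1 \<le> real l" using elim(3) exp_le by linarith
    then have LogF: "LogF (real l) = ln (real l)" by (simp add: LogF_def max_def)
    have d: "0 < damp l" using elim(3) by (intro damp_pos) simp
    have P: "0 < LogF (real l) powr (2 / r)" using LogF_ge_1[of "real l"] by simp
    have f0: "0 \<le> ?f l" by simp
    have "lam l - C * ?f l \<le> ?f l"
      using elim(1) abs_ge_self[of "lam l - C * ?f l"] unfolding real_norm_def mult_1 abs_of_nonneg[OF f0]
      by linarith
    then have "lam l \<le> (C + 1) * ?f l" unfolding distrib_right mult_1 by linarith
    also have "\<dots> = outer l * ((C + 1) / LogF (real l) powr (2 / r))" by simp
    also have "\<dots> \<le> outer l * (1 / damp l)"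
      using elim(2) d P unfolding LogF by (intro mult_left_mono) (auto simp: divide_simps mult.commute)
    finally show "lam l \<le> inner l" by simp
  qed
qed

lemma outer_le: "1 \<le> l \<Longrightarrow> outer l \<le> real l"
  using r_range powr_mono[of "1 / r" 1 "real l"] by simp

lemma case_first_moment:
  fixes y :: "nat \<Rightarrow> real"
  assumes r: "r = 1" and mean0: "expectation (eps 1) = 0"
    and y2: "\<And>n. (\<Sum>k=1..n. (y k)\<^sup>2) \<le> C * real n"
    and fin: "(\<Sum>l. \<Sum>k\<in>{1..<l}. ennreal \<bar>y k * y l\<bar> *
      (\<integral>\<^sup>+ t \<in> {real l..}. ennreal (1 / t ^ 3 * G_cov M (eps k) (eps l) t) \<partial>lborel)) < \<infinity>"
  shows "AE \<omega> in M. (\<lambda>n. (\<Sum>k=1..n. y k * eps k \<omega>) / real n) \<longlonglongrightarrow> 0"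
proof -
  \<comment> \<open>The covariance estimates require nonnegative weights; the positive and the
    negative part of y are both dominated by |y|, so one argument covers them.\<close>
  have nonneg_weights: "AE \<omega> in M. (\<lambda>n. (\<Sum>k=1..n. a k * eps k \<omega>) / real n) \<longlonglongrightarrow> 0"
    if a: "\<And>k. 0 \<le> a k" "\<And>k. a k \<le> \<bar>y k\<bar>" for a
  proof (rule slln_first_moment[where C = C])
    show "(\<Sum>k=1..n. (a k)\<^sup>2) \<le> C * real n" for n
      by (rule order_trans[OF sum_mono y2]) (use a in \<open>simp add: abs_le_square_iff[symmetric]\<close>)
    show "summable (\<lambda>l. real l powr (- 2 / r) * (\<Sum>k\<in>{1..<l}. a k * a l * G_cov M (eps k) (eps l) (real l)))"
    proof (rule summable_G_cov_of_integral[OF a(1) _ fin])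
      show "a k * a l \<le> \<bar>y k * y l\<bar>" for k l
        unfolding abs_mult using a by (intro mult_mono) auto
      show "\<forall>\<^sub>F l in sequentially. 0 < real l \<and> {real l..2 * real l} \<subseteq> {real l..} \<and>
          (\<forall>t. real l \<le> t \<longrightarrow> t \<le> 2 * real l \<longrightarrow> real l powr (- 2 / r) / (8 * real l) \<le> 1 / t ^ 3)"
        using eventually_ge_at_top[of 1]
      proof (eventually_elim, intro conjI allI impI)
        fix l :: nat and t :: real assume l: "1 \<le> l" and t: "real l \<le> t" "t \<le> 2 * real l"
        have "real l powr (- 2 / r) / (8 * real l) = 1 / (2 * real l) ^ 3"
          using l unfolding r by (simp add: powr_minus_divide power3_eq_cube power2_eq_square)
        also have "\<dots> \<le> 1 / t ^ 3" using t l by (intro divide_left_mono power_mono) auto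
        finally show "real l powr (- 2 / r) / (8 * real l) \<le> 1 / t ^ 3" .
      qed auto
    qed simp
  qed (use a r mean0 in auto)
  have "AE \<omega> in M. (\<lambda>n. (\<Sum>k=1..n. max 0 (y k) * eps k \<omega>) / real n) \<longlonglongrightarrow> 0"
    "AE \<omega> in M. (\<lambda>n. (\<Sum>k=1..n. max 0 (- y k) * eps k \<omega>) / real n) \<longlonglongrightarrow> 0"
    by (rule nonneg_weights; simp)+
  then show ?thesis
    by eventually_elim (rule signed_weights_tendsto_0)
qed

lemma case_higher_moment:
  fixes y lam :: "nat \<Rightarrow> real"
  assumes mean0: "expectation (eps 1) = 0"
    and y2: "\<And>n. (\<Sum>k=1..n. (y k)\<^sup>2) \<le> C * real n"
    and lam: "\<forall>\<^sub>F l in sequentially. lam l \<le> inner l"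
    and fin: "(\<Sum>l. \<Sum>k\<in>{1..<l}. ennreal \<bar>y k * y l\<bar> *
      (\<integral>\<^sup>+ t \<in> {t. lam l \<le> t \<and> 0 < t}.
        ennreal ((1 / (t ^ 3 * (LogF t)\<^sup>2) + 1 / (max t (exp 1) * t ^ 2 * (LogF t) ^ 3))
          * G_cov M (eps k) (eps l) t) \<partial>lborel)) < \<infinity>"
  shows "AE \<omega> in M. (\<lambda>n. (\<Sum>k=1..n. y k * eps k \<omega>) / norming n) \<longlonglongrightarrow> 0"
proof -
  have nonneg_weights: "AE \<omega> in M. (\<lambda>n. (\<Sum>k=1..n. a k * eps k \<omega>) / norming n) \<longlonglongrightarrow> 0"
    if a: "\<And>k. 0 \<le> a k" "\<And>k. a k \<le> \<bar>y k\<bar>" for a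
  proof (rule slln_higher_moment[where C = C])
    have ax: "a k * a l \<le> \<bar>y k * y l\<bar>" for k l
      unfolding abs_mult using a by (intro mult_mono) auto
    \<comment> \<open>One statement serves both levels: the weight 1 / (s \<open>damp l\<close>)^2
      is l^(-2/r) at s = \<open>inner l\<close>, and smaller by the square of \<open>damp l\<close>
      at s = \<open>outer l\<close>.\<close>
    have window: "\<forall>\<^sub>F l in sequentially. 0 < s l \<and> {s l..2 * s l} \<subseteq> {t. lam l \<le> t \<and> 0 < t} \<and>
        (\<forall>t. s l \<le> t \<longrightarrow> t \<le> 2 * s l \<longrightarrow> w l / (8 * s l) \<le>
          1 / (t ^ 3 * (LogF t)\<^sup>2) + 1 / (max t (exp 1) * t ^ 2 * (LogF t) ^ 3))"
      if s: "\<And>l. 1 \<le> l \<Longrightarrow> inner l \<le> s l" "\<And>l. 1 \<le> l \<Longrightarrow> s l \<le> outer l"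
        and w: "\<And>l. 1 \<le> l \<Longrightarrow> w l = (1 / (s l * damp l))\<^sup>2" for s w
      using lam eventually_ge_at_top[of 1]
    proof eventually_elim
      case (elim l)
      have "0 < s l" "s l \<le> real l" "lam l \<le> s l"
        using s[OF elim(2)] inner_bounds(1)[OF elim(2)] outer_le[OF elim(2)] elim(1) by linarith+
      then show ?case
        unfolding w[OF elim(2)] using weight_le_kernel[OF elim(2)] by auto
    qed
    show "summable (\<lambda>l. real l powr (- 2 / r) * (\<Sum>k\<in>{1..<l}. a k * a l * G_cov M (eps k) (eps l) (inner l)))"
    proof (rule summable_G_cov_of_integral[OF a(1) ax fin _ window])
      show "inner l \<le> outer l" if "1 \<le> l" for l by (rule inner_bounds(2)[OF that])
      show "real l powr (- 2 / r) = (1 / (inner l * damp l))\<^sup>2" if "1 \<le> l" for l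
        using powr_square[of l 1] damp_pos[OF that] by simp
    qed auto
    show "summable (\<lambda>l. real l powr (- 2 / r) / (damp l)\<^sup>2 *
        (\<Sum>k\<in>{1..<l}. a k * a l * G_cov M (eps k) (eps l) (outer l)))"
    proof (rule summable_G_cov_of_integral[OF a(1) ax fin _ window])
      show "inner l \<le> outer l" if "1 \<le> l" for l by (rule inner_bounds(2)[OF that])
      show "real l powr (- 2 / r) / (damp l)\<^sup>2 = (1 / (outer l * damp l))\<^sup>2" for l
        using powr_square[of l 1] by (simp add: power_divide power_mult_distrib)
    qed auto
    show "(\<Sum>k=1..n. (a k)\<^sup>2) \<le> C * real n" for n
      by (rule order_trans[OF sum_mono y2]) (use a in \<open>simp add: abs_le_square_iff[symmetric]\<close>)
  qed (use a mean0 integrable_eps_1 in auto)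
  have "AE \<omega> in M. (\<lambda>n. (\<Sum>k=1..n. max 0 (y k) * eps k \<omega>) / norming n) \<longlonglongrightarrow> 0"
    "AE \<omega> in M. (\<lambda>n. (\<Sum>k=1..n. max 0 (- y k) * eps k \<omega>) / norming n) \<longlonglongrightarrow> 0"
    by (rule nonneg_weights; simp)+
  then show ?thesis
    by eventually_elim (rule signed_weights_tendsto_0)
qed

end

theorem theorem4:
  fixes M :: "'a measure" and eps :: "nat \<Rightarrow> 'a \<Rightarrow> real"
    and x :: "nat \<Rightarrow> 'p::finite \<Rightarrow> real" and \<beta> :: "real^'p" and r :: real
  assumes "prob_space M"
    and meas: "\<And>k. eps k \<in> borel_measurable M"
    and ident: "\<And>k. 1 \<le> k \<Longrightarrow> distr M borel (eps k) = distr M borel (eps 1)"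
    and pqd: "pairwise_PQD M eps"
    and r_range: "1 \<le> r" "r < 2"
    and moment: "integrable M (\<lambda>\<omega>. \<bar>eps 1 \<omega>\<bar> powr r)"
    and mean0: "(\<integral>\<omega>. eps 1 \<omega> \<partial>M) = 0"
    and nonsing: "\<exists>n0. \<forall>n\<ge>n0. invertible (XtX x n)"
    and design_bdd: "\<And>j. bdd_above (range (\<lambda>n::nat. (\<Sum>k=1..n. (x k j)\<^sup>2) / real n))"
    and cases:
      "(r = 1
        \<and> (\<forall>j. (\<lambda>n. matrix_inv (XtX x n) $ j $ j) \<in> O(\<lambda>n. 1 / real n))
        \<and> (\<forall>i j. (\<Sum>l. \<Sum>k\<in>{1..<l}. ennreal \<bar>x k i * x l j\<bar> *
               (\<integral>\<^sup>+ t \<in> {real l..}. ennreal (1 / t ^ 3 * G_cov M (eps k) (eps l) t) \<partial>lborel))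
             < \<infinity>))
       \<or>
       (1 < r \<and> r < 2
        \<and> (\<forall>j. (\<lambda>n. matrix_inv (XtX x n) $ j $ j)
                 \<in> O(\<lambda>n. real n powr (- 1 / r) / LogF (real n)))
        \<and> (\<exists>C::real. \<exists>lam::nat \<Rightarrow> real. C > 0
             \<and> (\<lambda>l. lam l - C * (real l powr (1 / r) / LogF (real l) powr (2 / r)))
                 \<in> o(\<lambda>l. real l powr (1 / r) / LogF (real l) powr (2 / r))
             \<and> (\<forall>i j. (\<Sum>l. \<Sum>k\<in>{1..<l}. ennreal \<bar>x k i * x l j\<bar> *
                   (\<integral>\<^sup>+ t \<in> {t. lam l \<le> t \<and> 0 < t}.
                      ennreal ((1 / (t ^ 3 * (LogF t)\<^sup>2)
                                + 1 / (max t (exp 1) * t ^ 2 * (LogF t) ^ 3))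
                               * G_cov M (eps k) (eps l) t) \<partial>lborel))
                 < \<infinity>)))"
  shows "AE \<omega> in M. (\<lambda>n. lse x \<beta> eps n \<omega>) \<longlonglongrightarrow> \<beta>"
proof -
  interpret pqd_sequence M eps r
    by (intro pqd_sequence.intro pqd_sequence_axioms.intro assms(1) meas ident pqd r_range moment)
  have "\<exists>C. \<forall>n. (\<Sum>k=1..n. (x k j)\<^sup>2) \<le> C * real n" for j
  proof -
    obtain C where C: "\<And>n. (\<Sum>k=1..n. (x k j)\<^sup>2) / real n \<le> C"
      using design_bdd[of j] unfolding bdd_above_def by auto
    have "(\<Sum>k=1..n. (x k j)\<^sup>2) \<le> C * real n" for n
      using C[of n] by (cases "n = 0") (auto simp: pos_divide_le_eq)
    then show ?thesis by blast
  qed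
  then obtain C where x2: "\<And>j n. (\<Sum>k=1..n. (x k j)\<^sup>2) \<le> C j * real n" by metis
  \<comment> \<open>Both cases end alike and differ only in the norming b; the finitely many columns
    share one null set.\<close>
  have conclude: ?thesis
    if b: "\<And>n. 1 \<le> n \<Longrightarrow> 0 < b n"
      and diag: "\<And>j. (\<lambda>n. matrix_inv (XtX x n) $ j $ j) \<in> O(\<lambda>n. 1 / b n)"
      and S: "\<And>j. AE \<omega> in M. (\<lambda>n. (\<Sum>k=1..n. x k j * eps k \<omega>) / b n) \<longlonglongrightarrow> 0" for b
  proof -
    have "AE \<omega> in M. \<forall>j\<in>UNIV. (\<lambda>n. (\<Sum>k=1..n. x k j * eps k \<omega>) / b n) \<longlonglongrightarrow> 0"
      by (intro AE_finite_allI S) simp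
    then show ?thesis
      by eventually_elim (intro lse_tendsto[OF nonsing b diag], auto)
  qed
  from cases show ?thesis
  proof (elim disjE conjE exE)
    assume r: "r = 1" and diag: "\<forall>j. (\<lambda>n. matrix_inv (XtX x n) $ j $ j) \<in> O(\<lambda>n. 1 / real n)"
      and fin: "\<forall>i j. (\<Sum>l. \<Sum>k\<in>{1..<l}. ennreal \<bar>x k i * x l j\<bar> *
        (\<integral>\<^sup>+ t \<in> {real l..}. ennreal (1 / t ^ 3 * G_cov M (eps k) (eps l) t) \<partial>lborel)) < \<infinity>"
    show ?thesis
    proof (rule conclude)
      show "AE \<omega> in M. (\<lambda>n. (\<Sum>k=1..n. x k j * eps k \<omega>) / real n) \<longlonglongrightarrow> 0" for j
        by (rule case_first_moment[OF r mean0 x2 fin[rule_format]])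
      show "(\<lambda>n. matrix_inv (XtX x n) $ j $ j) \<in> O(\<lambda>n. 1 / real n)" for j
        by (rule diag[rule_format])
    qed simp
  next
    fix C' lam
    assume diag: "\<forall>j. (\<lambda>n. matrix_inv (XtX x n) $ j $ j)
        \<in> O(\<lambda>n. real n powr (- 1 / r) / LogF (real n))"
      and lam: "0 < C'" "(\<lambda>l. lam l - C' * (real l powr (1 / r) / LogF (real l) powr (2 / r)))
        \<in> o(\<lambda>l. real l powr (1 / r) / LogF (real l) powr (2 / r))"
      and fin: "\<forall>i j. (\<Sum>l. \<Sum>k\<in>{1..<l}. ennreal \<bar>x k i * x l j\<bar> *
        (\<integral>\<^sup>+ t \<in> {t. lam l \<le> t \<and> 0 < t}.
          ennreal ((1 / (t ^ 3 * (LogF t)\<^sup>2) + 1 / (max t (exp 1) * t ^ 2 * (LogF t) ^ 3))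
            * G_cov M (eps k) (eps l) t) \<partial>lborel)) < \<infinity>"
    \<comment> \<open>\<open>damp n\<close> is at most 3 \<open>LogF n\<close>, so replacing the
      capped logarithm by the smooth one costs the constant 3.\<close>
    have rate: "(\<lambda>n. real n powr (- 1 / r) / LogF (real n)) \<in> O(\<lambda>n. 1 / norming n)"
    proof (rule bigoI[where c = 3])
      show "\<forall>\<^sub>F n in sequentially. norm (real n powr (- 1 / r) / LogF (real n)) \<le> 3 * norm (1 / norming n)"
        using eventually_ge_at_top[of 1]
      proof eventually_elim
        case (elim n)
        have "1 / LogF (real n) \<le> 3 / damp n"
          using damp_le_LogF[OF elim] damp_pos[OF elim] LogF_ge_1[of "real n"]
          by (simp add: divide_simps mult.commute)
        then have "1 / outer n * (1 / LogF (real n)) \<le> 1 / outer n * (3 / damp n)"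
          by (intro mult_left_mono) auto
        then show ?case
          using damp_pos[OF elim] LogF_ge_1[of "real n"] by (simp add: powr_minus_divide)
      qed
    qed
    show ?thesis
    proof (rule conclude)
      show "AE \<omega> in M. (\<lambda>n. (\<Sum>k=1..n. x k j * eps k \<omega>) / norming n) \<longlonglongrightarrow> 0" for j
        by (rule case_higher_moment[OF mean0 x2 eventually_lam_le_inner[OF lam] fin[rule_format]])
      show "(\<lambda>n. matrix_inv (XtX x n) $ j $ j) \<in> O(\<lambda>n. 1 / norming n)" for j
        by (rule landau_o.big_trans[OF diag[rule_format] rate])
    qed (rule norming_pos)
  qed
qed

end
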